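(* Let $N\ge1$, let $E\subset\mathfrak{LC}(\mathbb R^{2N},\mathbb R^N)$ have $L^1_{loc}$-equicontinuous $m$-bounds, and let $\Theta=\{\theta^I_j\}$ be the suitable set of moduli of continuity given by the $m$-bounds of $E$, i.e. $\theta^I_j(s)=\sup_{t\in I,\,f\in E}\int_t^{t+s}m^j_f(u)\,du$. Let $\mathcal C=C([-1,0],\mathbb R^N)$. (i) Let $(\phi_n)_{n\in\mathbb N}$ be a sequence in $\mathcal C$ converging uniformly to $\phi\in\mathcal C$ and let $\theta_0$ be a modulus of continuity shared by all the functions in $\{\phi_n: n\in\mathbb N\}\cup\{\phi\}$. Let $\overline\Theta=\{\bar\theta^I_j\}$ be the suitable set of moduli of continuity defined, for $I=[q_1,q_2]$, $q_1,q_2\in\mathbb Q$, and $j\in\mathbb N$, by $\bar\theta^I_j(s)=\max\{\theta^I_j(s),\theta_0(s)\}$. If $(f_n)_{n\in\mathbb N}$ is a sequence in $E$ converging to $f$ in $(\mathfrak{LC}(\mathbb R^{2N},\mathbb R^N),\sigma_{\Theta\overline\Theta})$, then $$x(\cdot,f_n,\phi_n)\xrightarrow{n\to\infty}x(\cdot,f,\phi)$$ uniformly in any $[-1,T]\subset I_{f,\phi}$. (ii) If additionally $E$ has $L^1_{loc}$-bounded $l$-bounds, then the same conclusion holds (for any sequence $(\phi_n)$ in $\mathcal C$ converging uniformly to $\phi\in\mathcal C$) when $(f_n)_{n\in\mathbb N}$ is a sequence in $E$ converging to $f$ in $(\mathfrak{LC}(\mathbb R^{2N},\mathbb R^N),\sigma_D)$,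 where $D$ is a countable dense subset of $\mathbb R^{2N}$.
   Context: $B_j$ is the closed ball of radius $j$ centered at the origin; $C(I,W)$ is the space of continuous functions $I\to W$. $L^1_{loc}$ is the set of real functions on $\mathbb R$ belonging to $L^1(I)$ for every compact interval $I$. $\mathfrak{LC}(\mathbb R^{2N},\mathbb R^N)$ is the set of functions $f:\mathbb R\times\mathbb R^{2N}\to\mathbb R^N$ such that: $f$ is Borel measurable; for every compact $K\subset\mathbb R^{2N}$ there are $m^K,l^K\in L^1_{loc}$ such that for a.e. $t\in\mathbb R$, $|f(t,z)|\le m^K(t)$ and $|f(t,z_1)-f(t,z_2)|\le l^K(t)|z_1-z_2|$ for all $z,z_1,z_2\in K$. Functions differing only on a negligible set are identified. Optimal bounds of $f$ on $B_j\subset\mathbb R^{2N}$: $m^j_f(t)=\sup_{z\in B_j}|f(t,z)|$, $l^j_f(t)=\sup_{z_1\ne z_2\in B_j}|f(t,z_1)-f(t,z_2)|/|z_1-z_2|$. $E$ has $L^1_{loc}$-equicontinuous $m$-bounds if for every $j\in\mathbb N$, $r>0$ and $\varepsilon>0$ there is $\delta>0$ such that $\sup_{f\in E}\int_s^t m^j_f(u)\,du<\varepsilon$ whenever $-r\le s\le t\le r$, $t-s<\delta$. $E$ has $L^1_{loc}$-bounded $l$-bounds if $\sup_{f\in E}\int_{-r}^r l^j_f(t)\,dt<\infty$ for every $j\in\mathbb N$, $r>0$. A suitable set of moduli of continuity is a countable set $\{\theta^I_j: j\in\mathbb N,\ I=[q_1,q_2],\ q_1,q_2\in\mathbb Q\}$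 of non-decreasing continuous functions $[0,\infty)\to[0,\infty)$ with $\theta^I_j(0)=0$ and $\theta^{I_1}_{j_1}\le\theta^{I_2}_{j_2}$ whenever $I_1\subseteq I_2$, $j_1\le j_2$. A modulus of continuity is here a non-decreasing continuous function $\theta_0:[0,\infty)\to[0,\infty)$ with $\theta_0(0)=0$; it is a modulus of continuity for $x$ if $|x(t)-x(s)|\le\theta_0(|t-s|)$ for all $t,s$. $\mathcal K^I_j$ (resp. $\overline{\mathcal K}^I_j$) is the set of functions in $C(I,B_j)$, $B_j\subset\mathbb R^N$, admitting $\theta^I_j$ (resp. $\bar\theta^I_j$) as a modulus of continuity. Topologies, generated by the following seminorms over all $I=[q_1,q_2]$, $q_1,q_2\in\mathbb Q$, $j\in\mathbb N$ ($I-1$ is the translate of $I$): - $\sigma_{\Theta\overline\Theta}$: $\sup_{x\in\mathcal K^I_j,\,u\in\overline{\mathcal K}^{I-1}_j}\left|\int_If(t,x(t),u(t-1))\,dt\right|$; - $\sigma_D$: $\left|\int_If(t,z)\,dt\right|$, $z\in D$. For $f\in\mathfrak{LC}(\mathbb R^{2N},\mathbb R^N)$ and $\phi\in\mathcal C$, $x(\cdot,f,\phi)$ denotes the unique maximal continuous (Carathéodory) solution, with maximal interval of definition $I_{f,\phi}=[-1,b_{f,\phi})$, of $\dot x=f(t,x(t),x(t-1))$ for $t>0$, $x(t)=\phi(t)$ for $t\in[-1,0]$; if $b_{f,\phi}<\infty$ then $|x(t,f,\phi)|\to\infty$ as $t\to b_{f,\phi}$. Convergence on $[-1,T]$ is understood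 for $n$ large enough that $[-1,T]\subset I_{f_n,\phi_n}$, this being part of the assertion. *)

theory Defs
  imports "HOL-Analysis.Analysis"
begin

(* R^N is real^'n, and R^(2N) is (real^'n) \<times> (real^'n), whose product norm is the
   Euclidean norm of R^(2N).  The elements of LC are represented by functions (not by
   classes modulo negligible sets): none of the notions below depends on the choice of
   representatives. *)

type_synonym 'n rhs = "real \<Rightarrow> (real^'n) \<times> (real^'n) \<Rightarrow> real^'n"

definition L1_loc :: "(real \<Rightarrow> real) set" where
  "L1_loc = {m. \<forall>a b. set_integrable lebesgue {a..b} m}"

definition LC :: "('n::finite) rhs set" where
  "LC = {f. case_prod f \<in> borel_measurable borel \<and>
     (\<forall>K. compact K \<longrightarrow>
       (\<exists>m\<in>L1_loc. \<exists>l\<in>L1_loc. AE t in lebesgue.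
          (\<forall>z\<in>K. norm (f t z) \<le> m t) \<and>
          (\<forall>z1\<in>K. \<forall>z2\<in>K. norm (f t z1 - f t z2) \<le> l t * norm (z1 - z2))))}"

(* Optimal bounds on the ball of radius j.  They take values in [0, \<infinity>], because on a
   null set of times a representative may be unbounded, or not Lipschitz, on the ball.
   For f in LC they are Lebesgue measurable, but perhaps not Borel measurable, in t;
   this is why integrals are taken with respect to the completed measure lebesgue. *)

definition m_bound :: "('n::finite) rhs \<Rightarrow> nat \<Rightarrow> real \<Rightarrow> ennreal" where
  "m_bound f j t = (SUP z\<in>cball 0 (real j). ennreal (norm (f t z)))"

definition l_bound :: "('n::finite) rhs \<Rightarrow> nat \<Rightarrow> real \<Rightarrow> ennreal" where
  "l_bound f j t =
     (SUP (z1, z2)\<in>{(z1, z2). z1 \<in> cball 0 (real j) \<and> z2 \<in> cball 0 (real j) \<and> z1 \<noteq> z2}.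
        ennreal (norm (f t z1 - f t z2) / norm (z1 - z2)))"

definition equicontinuous_m_bounds :: "('n::finite) rhs set \<Rightarrow> bool" where
  "equicontinuous_m_bounds E \<longleftrightarrow>
     (\<forall>j::nat. \<forall>r>0. \<forall>\<epsilon>>0. \<exists>\<delta>>0. \<forall>s t. - r \<le> s \<and> s \<le> t \<and> t \<le> r \<and> t - s < \<delta> \<longrightarrow>
        (SUP f\<in>E. \<integral>\<^sup>+u\<in>{s..t}. m_bound f j u \<partial>lebesgue) < ennreal \<epsilon>)"

definition bounded_l_bounds :: "('n::finite) rhs set \<Rightarrow> bool" where
  "bounded_l_bounds E \<longleftrightarrow>
     (\<forall>j::nat. \<forall>r>0. (SUP f\<in>E. \<integral>\<^sup>+t\<in>{- r..r}. l_bound f j t \<partial>lebesgue) < \<infinity>)"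

definition is_modulus :: "(real \<Rightarrow> real) \<Rightarrow> bool" where
  "is_modulus \<theta> \<longleftrightarrow> mono_on {0..} \<theta> \<and> continuous_on {0..} \<theta> \<and> \<theta> 0 = 0"

definition admits_modulus :: "real set \<Rightarrow> (real \<Rightarrow> 'a::real_normed_vector) \<Rightarrow> (real \<Rightarrow> real) \<Rightarrow> bool" where
  "admits_modulus I x \<theta> \<longleftrightarrow> (\<forall>t\<in>I. \<forall>s\<in>I. norm (x t - x s) \<le> \<theta> \<bar>t - s\<bar>)"

(* \<Theta> j q1 q2 is the modulus with index j and I = [q1, q2]. *)
type_synonym moduli = "nat \<Rightarrow> real \<Rightarrow> real \<Rightarrow> real \<Rightarrow> real"

(* The supremum is finite when E has equicontinuous m-bounds, since t and t + s range over
   a bounded interval. *)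
definition m_moduli :: "('n::finite) rhs set \<Rightarrow> moduli" where
  "m_moduli E j q1 q2 s =
     enn2real (SUP (t, f)\<in>{q1..q2} \<times> E. \<integral>\<^sup>+u\<in>{t..t + s}. m_bound f j u \<partial>lebesgue)"

definition max_moduli :: "moduli \<Rightarrow> (real \<Rightarrow> real) \<Rightarrow> moduli" where
  "max_moduli \<Theta> \<theta>0 j q1 q2 s = max (\<Theta> j q1 q2 s) (\<theta>0 s)"

(* The elements are total functions; only their values on [q1, q2] are relevant. *)
definition moduli_class :: "moduli \<Rightarrow> nat \<Rightarrow> real \<Rightarrow> real \<Rightarrow> (real \<Rightarrow> real^'n::finite) set" where
  "moduli_class \<Theta> j q1 q2 =
     {x. continuous_on {q1..q2} x \<and> x ` {q1..q2} \<subseteq> cball 0 (real j) \<and>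
         admits_modulus {q1..q2} x (\<Theta> j q1 q2)}"

(* The supremum is over a bounded nonempty set of reals when f is in LC and the moduli are
   nonnegative. *)
definition seminorm_Theta :: "moduli \<Rightarrow> moduli \<Rightarrow> nat \<Rightarrow> real \<Rightarrow> real \<Rightarrow> ('n::finite) rhs \<Rightarrow> real" where
  "seminorm_Theta \<Theta> \<Theta>' j q1 q2 f =
     (SUP (x, u)\<in>moduli_class \<Theta> j q1 q2 \<times> moduli_class \<Theta>' j (q1 - 1) (q2 - 1).
        norm (LINT t:{q1..q2}|lebesgue. f t (x t, u (t - 1))))"

definition seminorm_point :: "(real^'n) \<times> (real^'n) \<Rightarrow> real \<Rightarrow> real \<Rightarrow> ('n::finite) rhs \<Rightarrow> real" where
  "seminorm_point z q1 q2 f = norm (LINT t:{q1..q2}|lebesgue. f t z)"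

definition LC_topology :: "(('n::finite) rhs \<Rightarrow> real) set \<Rightarrow> 'n rhs topology" where
  "LC_topology P = topology_generated_by
     {{g \<in> LC. p (\<lambda>t z. g t z - f t z) < \<epsilon>} | f p \<epsilon>. f \<in> LC \<and> p \<in> P \<and> 0 < \<epsilon>}"

definition sigma_Theta :: "moduli \<Rightarrow> moduli \<Rightarrow> ('n::finite) rhs topology" where
  "sigma_Theta \<Theta> \<Theta>' =
     LC_topology {seminorm_Theta \<Theta> \<Theta>' j q1 q2 | j q1 q2. q1 \<in> \<rat> \<and> q2 \<in> \<rat> \<and> q1 \<le> q2}"

definition sigma_D :: "((real^'n) \<times> (real^'n)) set \<Rightarrow> ('n::finite) rhs topology" where
  "sigma_D D =
     LC_topology {seminorm_point z q1 q2 | z q1 q2. z \<in> D \<and> q1 \<in> \<rat> \<and> q2 \<in> \<rat> \<and> q1 \<le> q2}"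

(* Absolute continuity: d ranges over the finite families of non-overlapping compact
   intervals [Inf k, Sup k] contained in S. *)
definition absolutely_continuous_on :: "real set \<Rightarrow> (real \<Rightarrow> 'a::real_normed_vector) \<Rightarrow> bool" where
  "absolutely_continuous_on S g \<longleftrightarrow>
     (\<forall>\<epsilon>>0. \<exists>\<delta>>0. \<forall>d. d division_of \<Union>d \<and> \<Union>d \<subseteq> S \<and> (\<Sum>k\<in>d. Sup k - Inf k) < \<delta> \<longrightarrow>
        (\<Sum>k\<in>d. norm (g (Sup k) - g (Inf k))) < \<epsilon>)"

(* x is a Caratheodory solution on [-1, b) of x'(t) = f(t, x(t), x(t - 1)), t > 0, with
   x = \<phi> on [-1, 0]. *)
definition dde_solution ::
  "('n::finite) rhs \<Rightarrow> (real \<Rightarrow> real^'n) \<Rightarrow> ereal \<Rightarrow> (real \<Rightarrow> real^'n) \<Rightarrow> bool" where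
  "dde_solution f \<phi> b x \<longleftrightarrow>
     0 < b \<and>
     continuous_on {t. - 1 \<le> t \<and> ereal t < b} x \<and>
     (\<forall>t\<in>{- 1..0}. x t = \<phi> t) \<and>
     (\<forall>T. 0 \<le> T \<and> ereal T < b \<longrightarrow> absolutely_continuous_on {0..T} x) \<and>
     (AE t in lebesgue. 0 < t \<and> ereal t < b \<longrightarrow>
        (x has_vector_derivative f t (x t, x (t - 1))) (at t))"

definition maximal_dde_solution ::
  "('n::finite) rhs \<Rightarrow> (real \<Rightarrow> real^'n) \<Rightarrow> ereal \<Rightarrow> (real \<Rightarrow> real^'n) \<Rightarrow> bool" where
  "maximal_dde_solution f \<phi> b x \<longleftrightarrow>
     dde_solution f \<phi> b x \<and>
     (\<forall>c y. dde_solution f \<phi> c y \<and> b \<le> c \<and> (\<forall>t. - 1 \<le> t \<and> ereal t < b \<longrightarrow> y t = x t) \<longrightarrow> c = b)"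

(* For f in LC and continuous \<phi> the pair (b, x) is unique, except for the irrelevant values
   of the total function x outside [-1, b). *)
definition dde_max :: "('n::finite) rhs \<Rightarrow> (real \<Rightarrow> real^'n) \<Rightarrow> ereal \<times> (real \<Rightarrow> real^'n)" where
  "dde_max f \<phi> = (SOME (b, x). maximal_dde_solution f \<phi> b x)"

definition dde_interval :: "('n::finite) rhs \<Rightarrow> (real \<Rightarrow> real^'n) \<Rightarrow> real set" where
  "dde_interval f \<phi> = {t. - 1 \<le> t \<and> ereal t < fst (dde_max f \<phi>)}"

definition dde_sol :: "('n::finite) rhs \<Rightarrow> (real \<Rightarrow> real^'n) \<Rightarrow> real \<Rightarrow> real^'n" where
  "dde_sol f \<phi> = snd (dde_max f \<phi>)"

definition solutions_converge ::
  "(nat \<Rightarrow> ('n::finite) rhs) \<Rightarrow> (nat \<Rightarrow> real \<Rightarrow> real^'n) \<Rightarrow> 'n rhs \<Rightarrow> (real \<Rightarrow> real^'n) \<Rightarrow> bool" where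
  "solutions_converge fs \<phi>s f \<phi> \<longleftrightarrow>
     (\<forall>T. {- 1..T} \<subseteq> dde_interval f \<phi> \<longrightarrow>
        (\<forall>\<^sub>F n in sequentially. {- 1..T} \<subseteq> dde_interval (fs n) (\<phi>s n)) \<and>
        uniform_limit {- 1..T} (\<lambda>n. dde_sol (fs n) (\<phi>s n)) (dde_sol f \<phi>) sequentially)"

end

theory Submission
  imports Defs
begin

text \<open>A Caratheodory solution is a continuous solution of the integral equation
  \<open>x(t) = \<phi>(0) + \<integral>\<^bsub>0\<^esub>\<^bsup>t\<^esup> f(s, x(s), x(s - 1)) ds\<close>. For the solution \<open>x\<close> of the limit equation and a
  solution \<open>x\<^sub>n\<close> of the \<open>n\<close>-th equation, both in a fixed ball, \<open>x\<^sub>n - x\<close> is the sum of the integral of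
  \<open>f(s, x\<^sub>n(s), x\<^sub>n(s - 1)) - f(s, x(s), x(s - 1))\<close>, which is absorbed over time steps on which the integral of
  the Lipschitz bound of \<open>f\<close> is at most \<open>1/4\<close>, and of the integral of the error \<open>f\<^sub>n - f\<close> along \<open>x\<^sub>n\<close> itself.
  The \<open>m\<close>-bounds make the \<open>x\<^sub>n\<close> equicontinuous, so that the error is controlled by the seminorms: directly
  in the topology with moduli of continuity, and after replacing \<open>x\<^sub>n\<close> by a step function with values in
  \<open>D\<close> in the pointwise topology. Closeness to \<open>x\<close> and the blow-up alternative show that \<open>x\<^sub>n\<close> lives at
  least as long as \<open>x\<close>.\<close>

section \<open>Absolutely continuous functions and indefinite integrals\<close>

text \<open>The obstacle is circular: the error along an approximating solution can be estimated
  only while that solution stays in a fixed ball, and it stays there only because it is close to x.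
  The ball is therefore taken one unit larger than x requires, and the first time at distance 1 from
  x is excluded by an estimate that is strictly below 1 there. Because of the delay, the difference
  of the solutions at t - 1 enters as well as that at t, so the Lipschitz term is estimated by the
  maximum of the distance over all of [-1, t]. The norm of a pair is at most twice that maximum, so
  the bound 1/4 leaves at most one half of it to absorb. The same factor 2 is the reason why
  solutions in the ball of radius J are tested with bounds and moduli of index 2 J. The limit f need
  not belong to E, so its own bounds are used wherever it is estimated. The seminorms see only
  intervals with rational endpoints, so the error on [0, t] is split over a rational mesh, and the
  last incomplete cell is left to the m-bounds.\<close>

lemma integral_norm_bound_AE:
  fixes F :: "real \<Rightarrow> 'b::euclidean_space"
  assumes "F integrable_on S" "g integrable_on S"
    and "AE t in lebesgue. t \<in> S \<longrightarrow> norm (F t) \<le> g t"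
  shows "norm (integral S F) \<le> integral S g"
proof -
  obtain N where N: "negligible N" "{t. \<not> (t \<in> S \<longrightarrow> norm (F t) \<le> g t)} \<subseteq> N"
    using assms(3) by (auto simp: eventually_ae_filter_negligible)
  define F' where "F' t = (if t \<in> N then 0 else F t)" for t
  define g' where "g' t = (if t \<in> N then 0 else g t)" for t
  have "integral S F = integral S F'" "integral S g = integral S g'"
    by (rule integral_spike[OF N(1)]; simp add: F'_def g'_def)+
  moreover have "F' integrable_on S" "g' integrable_on S"
    by (rule integrable_spike[OF assms(1) N(1)] integrable_spike[OF assms(2) N(1)];
        simp add: F'_def g'_def)+
  then have "norm (integral S F') \<le> integral S g'"
    by (rule integral_norm_bound_integral) (use N(2) in \<open>auto simp: F'_def g'_def\<close>)
  ultimately show ?thesis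
    by simp
qed

text \<open>Truncation at height \<open>k\<close> splits the integral: the part of \<open>h\<close>
  above \<open>k\<close> is small on all of \<open>S\<close> by dominated convergence, and the part
  below is at most \<open>k\<close> times the measure of the set.\<close>

lemma integral_small_on_small_sets:
  fixes h :: "real \<Rightarrow> real"
  assumes h: "h absolutely_integrable_on S" and S: "S \<in> sets lebesgue"
    and nonneg: "\<And>t. t \<in> S \<Longrightarrow> 0 \<le> h t" and "0 < e"
  obtains d where "0 < d"
    "\<And>A. A \<in> lmeasurable \<Longrightarrow> A \<subseteq> S \<Longrightarrow> measure lebesgue A < d \<Longrightarrow> integral A h < e"
proof -
  have hm: "h \<in> borel_measurable (lebesgue_on S)"
    using h S by (simp add: absolutely_integrable_measurable)
  have tr: "(\<lambda>t. min (h t) (real k)) absolutely_integrable_on S" for k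
  proof (rule measurable_bounded_by_integrable_imp_absolutely_integrable[OF _ S])
    show "(\<lambda>t. min (h t) (real k)) \<in> borel_measurable (lebesgue_on S)"
      using hm by measurable
    show "h integrable_on S"
      using h set_lebesgue_integral_eq_integral by blast
    show "norm (min (h t) (real k)) \<le> h t" if "t \<in> S" for t
      using nonneg[OF that] by auto
  qed
  have "(\<lambda>k. integral S (\<lambda>t. min (h t) (real k))) \<longlonglongrightarrow> integral S h"
  proof (rule dominated_convergence(2))
    show "(\<lambda>t. min (h t) (real k)) integrable_on S" for k
      using tr set_lebesgue_integral_eq_integral by blast
    show "h integrable_on S"
      using h set_lebesgue_integral_eq_integral by blast
    show "norm (min (h t) (real k)) \<le> h t" if "t \<in> S" for t k
      using nonneg[OF that] by auto
    fix t assume "t \<in> S"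
    obtain n where "h t \<le> real n"
      using real_arch_simple by blast
    then have "\<forall>\<^sub>F k in sequentially. min (h t) (real k) = h t"
      by (auto simp: eventually_sequentially min_def intro!: exI[of _ n])
    then show "(\<lambda>k. min (h t) (real k)) \<longlonglongrightarrow> h t"
      by (rule tendsto_eventually)
  qed
  then have "\<forall>\<^sub>F k in sequentially. integral S h - integral S (\<lambda>t. min (h t) (real k)) < e / 2"
    using \<open>0 < e\<close> unfolding tendsto_iff dist_real_def
    by (elim allE[of _ "e/2"]) (auto elim!: eventually_mono simp: abs_if split: if_splits)
  then obtain k where k: "integral S h - integral S (\<lambda>t. min (h t) (real k)) < e / 2"
    by (auto simp: eventually_sequentially)
  let ?h = "\<lambda>t. min (h t) (real k)"
  show thesis
  \<comment> \<open>The summand 1 keeps the quotient meaningful when \<open>k\<close> is 0.\<close>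
  proof (rule that[of "e / (2 * (real k + 1))"])
    fix A assume A: "A \<in> lmeasurable" "A \<subseteq> S" "measure lebesgue A < e / (2 * (real k + 1))"
    have sub: "h absolutely_integrable_on A" "?h absolutely_integrable_on A"
      using A h tr[of k] by (auto intro: set_integrable_subset)
    have i: "h integrable_on A" "?h integrable_on A" "h integrable_on S" "?h integrable_on S"
      using sub h tr[of k] set_lebesgue_integral_eq_integral by blast+
    have "integral A h - integral A ?h = integral A (\<lambda>t. h t - ?h t)"
      using i by (simp add: integral_diff)
    also have "\<dots> \<le> integral S (\<lambda>t. h t - ?h t)"
      by (rule integral_subset_le[OF A(2)]) (use i in \<open>auto intro: integrable_diff\<close>)
    also have "\<dots> = integral S h - integral S ?h"
      using i by (simp add: integral_diff)
    finally have "integral A h < integral A ?h + e / 2"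
      using k by linarith
    moreover have "integral A ?h \<le> integral A (\<lambda>t. real k)"
      by (rule integral_le) (use i A in \<open>auto intro: integrable_on_const\<close>)
    moreover have "integral A (\<lambda>t. real k) = real k * measure lebesgue A"
      using lmeasure_integral[OF A(1)] integral_mult_right[of A "real k" "\<lambda>_. 1::real"] by simp
    moreover have "real k * measure lebesgue A \<le> (real k + 1) * measure lebesgue A"
      by (simp add: mult_right_mono)
    moreover have "(real k + 1) * measure lebesgue A < e / 2"
      using A(3) by (simp add: field_simps)
    ultimately show "integral A h < e"
      by linarith
  qed (use \<open>0 < e\<close> in auto)
qed

corollary integral_small_on_short_intervals:
  fixes h :: "real \<Rightarrow> real"
  assumes h: "h absolutely_integrable_on {a..b}"
    and nonneg: "\<And>t. t \<in> {a..b} \<Longrightarrow> 0 \<le> h t" and "0 < e"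
  obtains d where "0 < d"
    "\<And>s t. a \<le> s \<Longrightarrow> t \<le> b \<Longrightarrow> t - s < d \<Longrightarrow> integral {s..t} h < e"
proof -
  obtain d where d: "0 < d"
    "\<And>A. A \<in> lmeasurable \<Longrightarrow> A \<subseteq> {a..b} \<Longrightarrow> measure lebesgue A < d \<Longrightarrow> integral A h < e"
    using integral_small_on_small_sets[OF h _ nonneg \<open>0 < e\<close>] by auto
  have "integral {s..t} h < e" if "a \<le> s" "t \<le> b" "t - s < d" for s t
  proof (rule d(2))
    show "measure lebesgue {s..t} < d"
      using that d(1) by (cases "s \<le> t") auto
  qed (use that in auto)
  with d(1) that show thesis
    by blast
qed

lemma division_of_real_intervalE:
  fixes d :: "real set set"
  assumes "d division_of S" "k \<in> d"
  obtains a b where "k = {a..b}" "a \<le> b" "Inf k = a" "Sup k = b"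
proof -
  obtain a b where "k = cbox a b" "k \<noteq> {}"
    using assms division_ofD by metis
  with that[of a b] show thesis
    by auto
qed

text \<open>The increment over an interval is at most the integral of the norm of \<open>F\<close>
  over it. For a non-overlapping family these add up to a single integral over the union, whose
  measure is the total length.\<close>

lemma absolutely_continuous_on_indefinite_integral:
  fixes F :: "real \<Rightarrow> 'b::euclidean_space"
  assumes F: "F absolutely_integrable_on {a..b}"
    and x: "\<And>t. t \<in> {a..b} \<Longrightarrow> x t = c + integral {a..t} F"
  shows "absolutely_continuous_on {a..b} x"
  unfolding absolutely_continuous_on_def
proof (intro allI impI)
  fix e :: real assume "0 < e"
  have nF: "(\<lambda>t. norm (F t)) absolutely_integrable_on {a..b}"
    using F by (rule set_integrable_norm)
  obtain d where d: "0 < d" "\<And>A. A \<in> lmeasurable \<Longrightarrow> A \<subseteq> {a..b} \<Longrightarrow> measure lebesgue A < d \<Longrightarrow>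
      integral A (\<lambda>t. norm (F t)) < e"
    using integral_small_on_small_sets[OF nF _ _ \<open>0 < e\<close>] by auto
  show "\<exists>\<delta>>0. \<forall>D. D division_of \<Union>D \<and> \<Union>D \<subseteq> {a..b} \<and> (\<Sum>k\<in>D. Sup k - Inf k) < \<delta> \<longrightarrow>
      (\<Sum>k\<in>D. norm (x (Sup k) - x (Inf k))) < e"
  proof (intro exI conjI allI impI)
    fix D :: "real set set"
    assume "D division_of \<Union>D \<and> \<Union>D \<subseteq> {a..b} \<and> (\<Sum>k\<in>D. Sup k - Inf k) < d"
    then have D: "D division_of \<Union>D" "\<Union>D \<subseteq> {a..b}" "(\<Sum>k\<in>D. Sup k - Inf k) < d"
      by auto
    have "norm (x (Sup k) - x (Inf k)) \<le> integral k (\<lambda>t. norm (F t))" if kD: "k \<in> D" for k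
    proof -
      obtain s t where k: "k = {s..t}" "s \<le> t" "Inf k = s" "Sup k = t"
        using division_of_real_intervalE[OF D(1) kD] by metis
      have ab: "a \<le> s" "t \<le> b"
        using k(1,2) UnionI[OF kD, of s] UnionI[OF kD, of t] D(2) by auto
      have "F integrable_on {a..t}"
        using ab absolutely_integrable_on_subinterval[OF F, of a t]
        by (auto intro: set_lebesgue_integral_eq_integral(1))
      then have "integral {a..s} F + integral {s..t} F = integral {a..t} F"
        using ab k by (intro Henstock_Kurzweil_Integration.integral_combine) auto
      then have "x t - x s = integral {s..t} F"
        using ab k by (simp add: x) (metis add_diff_cancel_left')
      moreover have "F absolutely_integrable_on {s..t}"
        using ab absolutely_integrable_on_subinterval[OF F, of s t] by auto
      ultimately show ?thesis
        using integral_norm_bound_AE[of F "{s..t}" "\<lambda>t. norm (F t)"] k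
        by (simp add: absolutely_integrable_on_def)
    qed
    then have "(\<Sum>k\<in>D. norm (x (Sup k) - x (Inf k))) \<le> (\<Sum>k\<in>D. integral k (\<lambda>t. norm (F t)))"
      by (rule sum_mono)
    also have "\<dots> = integral (\<Union>D) (\<lambda>t. norm (F t))"
    proof (rule integral_combine_division_topdown[symmetric, OF _ D(1)])
      have "(\<lambda>t. norm (F t)) absolutely_integrable_on \<Union>D"
        using nF D by (intro set_integrable_subset[OF nF])
          (auto intro!: fmeasurableD lmeasurable_division[OF D(1)])
      then show "(\<lambda>t. norm (F t)) integrable_on \<Union>D"
        by (rule set_lebesgue_integral_eq_integral(1))
    qed
    also have "\<dots> < e"
    proof (rule d(2))
      show "\<Union>D \<in> lmeasurable"
        using D(1) by (rule lmeasurable_division)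
      have "measure lebesgue (\<Union>D) = (\<Sum>k\<in>D. measure lebesgue k)"
        using content_division[OF D(1)] by simp
      also have "\<dots> = (\<Sum>k\<in>D. Sup k - Inf k)"
      proof (rule sum.cong[OF refl])
        fix k assume "k \<in> D"
        then obtain s t where "k = {s..t}" "s \<le> t" "Inf k = s" "Sup k = t"
          using division_of_real_intervalE[OF D(1)] by metis
        then show "measure lebesgue k = Sup k - Inf k"
          by simp
      qed
      finally show "measure lebesgue (\<Union>D) < d"
        using D(3) by simp
    qed (rule D(2))
    finally show "(\<Sum>k\<in>D. norm (x (Sup k) - x (Inf k))) < e" .
  qed (rule d(1))
qed

text \<open>Henstock's argument: tags outside the exceptional null set are controlled by differentiability,
  and the intervals tagged inside it lie in an open set of small measure, where absolute continuity
  applies.\<close>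

lemma fundamental_theorem_of_calculus_absolutely_continuous:
  fixes x :: "real \<Rightarrow> 'b::euclidean_space"
  assumes ac: "absolutely_continuous_on {a..b} x" and "a \<le> b"
    and deriv: "AE t in lebesgue. a < t \<and> t < b \<longrightarrow> (x has_vector_derivative F t) (at t)"
  shows "(F has_integral x b - x a) {a..b}"
proof -
  obtain N0 where N0: "negligible N0"
    "{t. \<not> (a < t \<and> t < b \<longrightarrow> (x has_vector_derivative F t) (at t))} \<subseteq> N0"
    using deriv by (auto simp: eventually_ae_filter_negligible)
  \<comment> \<open>The endpoints join the null set because differentiability is assumed only inside
    the interval.\<close>
  define N where "N = insert a (insert b N0)"
  have N: "negligible N"
    using N0(1) by (simp add: N_def)
  \<comment> \<open>With value 0 on \<open>N\<close>, an interval tagged in \<open>N\<close>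
    contributes only the increment of \<open>x\<close>.\<close>
  define G where "G t = (if t \<in> N then 0 else F t)" for t
  have der: "(x has_vector_derivative G t) (at t)" if "t \<in> {a..b} - N" for t
    using that N0(2) by (force simp: G_def N_def)
  have "(G has_integral x b - x a) {a..b}"
    unfolding has_integral_factor_content_real
  proof (intro allI impI)
    fix e0 :: real assume "0 < e0"
    show "\<exists>\<gamma>. gauge \<gamma> \<and> (\<forall>p. p tagged_division_of {a..b} \<and> \<gamma> fine p \<longrightarrow>
      norm ((\<Sum>(t, k)\<in>p. measure lborel k *\<^sub>R G t) - (x b - x a)) \<le> e0 * measure lborel {a..b})"
    \<comment> \<open>Absolute continuity is used below with tolerance \<open>e * (b - a)\<close>,
      which must be positive.\<close>
    proof (cases "a = b")
      case True
      have "norm ((\<Sum>(t, k)\<in>p. measure lborel k *\<^sub>R G t) - (x b - x a)) \<le> e0 * measure lborel {a..b}"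
        if "p tagged_division_of {a..b}" for p
        using sum_content_null[of a b p G] that True by simp
      then show ?thesis
        using gauge_ball[of 1] by blast
    next
      case False
      with \<open>a \<le> b\<close> have "a < b" by simp
      define e where "e = e0 / 2"
      have "0 < e" "0 < e * (b - a)"
        using \<open>0 < e0\<close> \<open>a < b\<close> by (auto simp: e_def)
      from ac[unfolded absolutely_continuous_on_def, rule_format, OF this(2)]
      obtain \<delta> where "0 < \<delta>" and \<delta>: "\<And>d. d division_of \<Union>d \<Longrightarrow> \<Union>d \<subseteq> {a..b} \<Longrightarrow>
          (\<Sum>k\<in>d. Sup k - Inf k) < \<delta> \<Longrightarrow> (\<Sum>k\<in>d. norm (x (Sup k) - x (Inf k))) < e * (b - a)"
        by auto
      have Ns: "N \<in> sets lebesgue"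
        using N by (simp add: negligible_imp_sets)
      then obtain U where U: "open U" "N \<subseteq> U" "U - N \<in> lmeasurable"
          "emeasure lebesgue (U - N) < ennreal \<delta>"
        using sets_lebesgue_outer_open \<open>0 < \<delta>\<close> by blast
      have Nl: "N \<in> lmeasurable" "measure lebesgue N = 0"
        using N negligible_imp_measurable negligible_imp_measure0 by auto
      have UN: "(U - N) \<union> N = U"
        using U(2) by blast
      then have Um: "U \<in> lmeasurable"
        using fmeasurable.Un[OF U(3) Nl(1)] by simp
      have "measure lebesgue (U - N) < \<delta>"
        using U(3,4) by (simp add: emeasure_eq_measure2 ennreal_less_iff)
      moreover have "measure lebesgue U \<le> measure lebesgue (U - N) + measure lebesgue N"
        using measure_Un_le[OF fmeasurableD[OF U(3)] Ns] unfolding UN .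
      ultimately have Ud: "measure lebesgue U < \<delta>"
        using Nl by simp
      have "\<forall>t\<in>{a..b} - N. \<exists>r. 0 < r \<and>
          (\<forall>y. norm (y - t) < r \<longrightarrow> norm (x y - x t - (y - t) *\<^sub>R G t) \<le> e * norm (y - t))"
        using der \<open>0 < e\<close> unfolding has_vector_derivative_def has_derivative_at_alt by simp
      from bchoice[OF this] obtain r where r': "\<forall>t\<in>{a..b} - N. 0 < r t \<and>
          (\<forall>y. norm (y - t) < r t \<longrightarrow> norm (x y - x t - (y - t) *\<^sub>R G t) \<le> e * norm (y - t))" ..
      have r: "\<And>t. t \<in> {a..b} - N \<Longrightarrow> 0 < r t"
        "\<And>t y. t \<in> {a..b} - N \<Longrightarrow> norm (y - t) < r t \<Longrightarrow>
            norm (x y - x t - (y - t) *\<^sub>R G t) \<le> e * norm (y - t)"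
        using r' by blast+
      define \<gamma> where "\<gamma> t = (if t \<in> N then U else if t \<in> {a..b} then ball t (r t) else UNIV)" for t
      have "gauge \<gamma>"
        using U(1,2) r(1) by (auto simp: gauge_def \<gamma>_def)
      moreover have "norm ((\<Sum>(t, k)\<in>p. measure lborel k *\<^sub>R G t) - (x b - x a)) \<le> e0 * measure lborel {a..b}"
        if p: "p tagged_division_of {a..b}" "\<gamma> fine p" for p
      proof -
        have fin: "finite p"
          using p(1) by blast
        have pk: "\<exists>u v. k = {u..v} \<and> u \<le> v \<and> t \<in> {u..v} \<and> Inf k = u \<and> Sup k = v \<and> a \<le> u \<and> v \<le> b \<and> k \<subseteq> \<gamma> t"
          if "(t, k) \<in> p" for t k
        proof -
          have 1: "t \<in> k" "k \<subseteq> {a..b}" "\<exists>u v. k = cbox u v"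
            using p(1) that by blast+
          then obtain u v where "k = {u..v}" by auto
          then show ?thesis
            using 1 p(2) that by (auto simp: fine_def intro!: exI[of _ u] exI[of _ v])
        qed
        define p1 where "p1 = {q \<in> p. fst q \<in> N}"
        define p2 where "p2 = {q \<in> p. fst q \<notin> N}"
        have pp: "p = p1 \<union> p2" "p1 \<inter> p2 = {}" "finite p1" "finite p2"
          using fin by (auto simp: p1_def p2_def)
        have "x b - x a = (\<Sum>(t, k)\<in>p. x (Sup k) - x (Inf k))"
          using additive_tagged_division_1[OF \<open>a \<le> b\<close> p(1), of x] by simp
        then have "(\<Sum>(t, k)\<in>p. measure lborel k *\<^sub>R G t) - (x b - x a) =
            (\<Sum>(t, k)\<in>p. measure lborel k *\<^sub>R G t - (x (Sup k) - x (Inf k)))"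
          by (simp add: sum_subtractf split_def)
        also have "\<dots> = (\<Sum>(t, k)\<in>p1. measure lborel k *\<^sub>R G t - (x (Sup k) - x (Inf k))) +
            (\<Sum>(t, k)\<in>p2. measure lborel k *\<^sub>R G t - (x (Sup k) - x (Inf k)))"
          using pp by (simp add: sum.union_disjoint)
        also have "norm \<dots> \<le> e * (b - a) + e * (b - a)"
        proof (rule norm_triangle_mono)
          have "norm (\<Sum>(t, k)\<in>p2. measure lborel k *\<^sub>R G t - (x (Sup k) - x (Inf k))) \<le>
              (\<Sum>(t, k)\<in>p2. e * measure lborel k)"
          proof (rule sum_norm_le, clarify)
            fix t k assume tk: "(t, k) \<in> p2"
            then obtain u v where k: "k = {u..v}" "u \<le> t" "t \<le> v" "Inf k = u" "Sup k = v" "a \<le> u" "v \<le> b" "k \<subseteq> \<gamma> t"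
              using pk[of t k] pp by auto
            have t: "t \<in> {a..b} - N"
              using tk k by (auto simp: p2_def)
            then have "k \<subseteq> ball t (r t)"
              using k(8) by (auto simp: \<gamma>_def)
            then have uv: "norm (u - t) < r t" "norm (v - t) < r t"
              using k by (auto simp: dist_real_def subset_iff dest: spec[of _ u] spec[of _ v])
            \<comment> \<open>Both ends are compared with the linear approximation at the tag; since
              the tag lies between them, the two distances add up to the length of the
              interval.\<close>
            have "measure lborel k *\<^sub>R G t - (x (Sup k) - x (Inf k)) =
                (x u - x t - (u - t) *\<^sub>R G t) - (x v - x t - (v - t) *\<^sub>R G t)"
              using k by (simp add: algebra_simps)
            also have "norm \<dots> \<le> e * norm (u - t) + e * norm (v - t)"
              using r(2)[OF t uv(1)] r(2)[OF t uv(2)] by (rule order_trans[OF norm_triangle_ineq4 add_mono])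
            also have "\<dots> = e * measure lborel k"
              using k by (simp add: algebra_simps)
            finally show "norm (measure lborel k *\<^sub>R G t - (x (Sup k) - x (Inf k))) \<le> e * measure lborel k" .
          qed
          also have "\<dots> \<le> (\<Sum>(t, k)\<in>p. e * measure lborel k)"
            using \<open>0 < e\<close> fin pp(1) by (intro sum_mono2) auto
          also have "\<dots> = e * (b - a)"
            using additive_content_tagged_division[of p a b] p(1) \<open>a \<le> b\<close>
            by (simp add: split_def flip: sum_distrib_left)
          finally show "norm (\<Sum>(t, k)\<in>p2. measure lborel k *\<^sub>R G t - (x (Sup k) - x (Inf k))) \<le> e * (b - a)" .
          have part: "p1 tagged_partial_division_of {a..b}"
            by (rule tagged_partial_division_subset[of p])
              (use p(1) in \<open>auto simp: tagged_division_of_def p1_def\<close>)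
          then have td: "p1 tagged_division_of \<Union>(snd ` p1)"
            by (rule tagged_partial_division_of_Union_self)
          then have dv: "snd ` p1 division_of \<Union>(snd ` p1)"
            by (rule division_of_tagged_division)
          \<comment> \<open>Passing from tagged pairs to intervals needs a summand that vanishes on
            intervals without interior; \<open>Inf\<close> and \<open>Sup\<close> of the empty set
            carry no information, hence the case distinction.\<close>
          define d where "d k = (if k = {} then 0 else norm (x (Sup k) - x (Inf k)))" for k
          have "norm (\<Sum>(t, k)\<in>p1. measure lborel k *\<^sub>R G t - (x (Sup k) - x (Inf k))) \<le> (\<Sum>(t, k)\<in>p1. d k)"
          proof (rule sum_norm_le, clarify)
            fix t k assume tk: "(t, k) \<in> p1"
            then have "t \<in> N" "t \<in> k"
              using p(1) by (auto simp: p1_def)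
            then show "norm (measure lborel k *\<^sub>R G t - (x (Sup k) - x (Inf k))) \<le> d k"
              by (auto simp: G_def d_def norm_minus_commute)
          qed
          also have "(\<Sum>(t, k)\<in>p1. d k) = (\<Sum>k\<in>snd ` p1. d k)"
            by (rule sum.over_tagged_division_lemma[OF td]) (auto simp: d_def)
          also have "\<dots> = (\<Sum>k\<in>snd ` p1. norm (x (Sup k) - x (Inf k)))"
            using division_ofD(3)[OF dv] by (intro sum.cong) (auto simp: d_def)
          also have "\<dots> < e * (b - a)"
          proof (rule \<delta>[OF dv])
            show "\<Union> (snd ` p1) \<subseteq> {a..b}"
            proof (rule Union_least, elim imageE)
              fix k q assume "k = snd q" "q \<in> p1"
              then show "k \<subseteq> {a..b}"
                using tagged_partial_division_ofD(3)[OF part, of "fst q" "snd q"] by simp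
            qed
            have "(\<Sum>k\<in>snd ` p1. Sup k - Inf k) = (\<Sum>k\<in>snd ` p1. measure lebesgue k)"
            proof (rule sum.cong[OF refl])
              fix k assume "k \<in> snd ` p1"
              then obtain s t where "k = {s..t}" "s \<le> t" "Inf k = s" "Sup k = t"
                using division_of_real_intervalE[OF dv] by metis
              then show "Sup k - Inf k = measure lebesgue k"
                by simp
            qed
            also have "\<dots> = measure lebesgue (\<Union> (snd ` p1))"
              using content_division[OF dv] by simp
            also have "\<dots> \<le> measure lebesgue U"
            proof (rule measure_mono_fmeasurable[OF _ _ Um])
              show "\<Union> (snd ` p1) \<subseteq> U"
              proof (rule Union_least, elim imageE)
                fix k q assume q: "k = snd q" "q \<in> p1"
                then have "k \<subseteq> \<gamma> (fst q)" "fst q \<in> N"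
                  using pk[of "fst q" "snd q"] by (auto simp: p1_def)
                then show "k \<subseteq> U"
                  by (simp add: \<gamma>_def)
              qed
              show "\<Union> (snd ` p1) \<in> sets lebesgue"
                using lmeasurable_division[OF dv] by (rule fmeasurableD)
            qed
            finally show "(\<Sum>k\<in>snd ` p1. Sup k - Inf k) < \<delta>"
              using Ud by simp
          qed
          finally show "norm (\<Sum>(t, k)\<in>p1. measure lborel k *\<^sub>R G t - (x (Sup k) - x (Inf k))) \<le> e * (b - a)"
            by simp
        qed
        also have "\<dots> = e0 * measure lborel {a..b}"
          using \<open>a \<le> b\<close> by (simp add: e_def)
        finally show ?thesis .
      qed
      ultimately show ?thesis
        by (intro exI[of _ \<gamma>] conjI allI impI) simp_all
    qed
  qed
  then show ?thesis
    using has_integral_spike_eq[OF N, of "{a..b}" F G "x b - x a"] by (simp add: G_def)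
qed

section \<open>Differentiation of indefinite integrals\<close>

lemma integral_right_derivativeE:
  fixes G :: "real \<Rightarrow> 'b::euclidean_space"
  assumes "\<And>u v. G integrable_on {u..v}"
  obtains N where "negligible N" "\<And>t e. t \<notin> N \<Longrightarrow> 0 < e \<Longrightarrow>
      \<exists>d>0. \<forall>h. 0 < h \<and> h < d \<longrightarrow> norm (integral {t..t + h} G /\<^sub>R h - G t) < e"
proof (rule integrable_ccontinuous_explicit[of G])
  show "G integrable_on cbox u v" for u v
    using assms by simp
qed (use that in \<open>simp add: Basis_real_def\<close>)

text \<open>Right difference quotients come from Lebesgue differentiation of \<open>F\<close>, left
  ones from the same result for the reflected function, whose exceptional set is reflected
  back.\<close>

lemma indefinite_integral_has_vector_derivative_AE:
  fixes F :: "real \<Rightarrow> 'b::euclidean_space"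
  assumes F: "F absolutely_integrable_on {a..b}"
  shows "AE t in lebesgue. a < t \<and> t < b \<longrightarrow>
    ((\<lambda>t. integral {a..t} F) has_vector_derivative F t) (at t)"
proof -
  \<comment> \<open>Extension by zero gives integrability on every interval, as the one-sided
    differentiation result requires.\<close>
  define G where "G t = (if t \<in> {a..b} then F t else 0)" for t
  have "G integrable_on UNIV"
    unfolding G_def integrable_restrict_UNIV using F by (rule set_lebesgue_integral_eq_integral(1))
  then have G: "G integrable_on {u..v}" for u v
    using integrable_on_subcbox[of G UNIV u v] by simp
  obtain N1 where N1: "negligible N1" "\<And>t e. t \<notin> N1 \<Longrightarrow> 0 < e \<Longrightarrow>
      \<exists>d>0. \<forall>h. 0 < h \<and> h < d \<longrightarrow> norm (integral {t..t + h} G /\<^sub>R h - G t) < e"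
    by (rule integral_right_derivativeE[OF G]) (rule that)
  have G': "(\<lambda>t. G (- t)) integrable_on {u..v}" for u v
    using G[of "- v" "- u"] Henstock_Kurzweil_Integration.integrable_reflect_real[where f = G and a = "- v" and b = "- u"] by simp
  obtain N2 where N2: "negligible N2" "\<And>t e. t \<notin> N2 \<Longrightarrow> 0 < e \<Longrightarrow>
      \<exists>d>0. \<forall>h. 0 < h \<and> h < d \<longrightarrow> norm (integral {t..t + h} (\<lambda>t. G (- t)) /\<^sub>R h - G (- t)) < e"
    by (rule integral_right_derivativeE[OF G']) (rule that)
  have "negligible (uminus ` N2)"
    by (rule negligible_differentiable_image_negligible[OF _ N2(1)])
      (auto intro!: derivative_intros simp: differentiable_on_def)
  then have N: "negligible (N1 \<union> uminus ` N2)"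
    using N1(1) by simp
  have "((\<lambda>t. integral {a..t} F) has_vector_derivative F t) (at t)"
    if t: "t \<notin> N1 \<union> uminus ` N2" "a < t" "t < b" for t
    unfolding has_vector_derivative_def has_derivative_at_alt
  proof (intro conjI allI impI)
    show "bounded_linear (\<lambda>x. x *\<^sub>R F t)"
      by (rule bounded_linear_scaleR_left)
    fix e :: real assume "0 < e"
    obtain d1 where d1: "d1 > 0" "\<And>h. 0 < h \<Longrightarrow> h < d1 \<Longrightarrow> norm (integral {t..t + h} G /\<^sub>R h - G t) < e"
      using N1(2)[of t e] t \<open>0 < e\<close> by auto
    have "- t \<notin> N2"
      using t by force
    then obtain d2 where d2: "d2 > 0" "\<And>h. 0 < h \<Longrightarrow> h < d2 \<Longrightarrow>
        norm (integral {-t..-t + h} (\<lambda>t. G (- t)) /\<^sub>R h - G t) < e"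
      using N2(2)[of "- t" e] \<open>0 < e\<close> by auto
    have Gt: "G t = F t"
      using t by (simp add: G_def)
    have FG: "integral {u..v} F = integral {u..v} G" if "a \<le> u" "v \<le> b" for u v
      by (rule integral_cong) (use that in \<open>auto simp: G_def\<close>)
    have diff: "integral {a..v} F - integral {a..u} F = integral {u..v} G"
      if "a \<le> u" "u \<le> v" "v \<le> b" for u v
    proof -
      have "integral {a..u} G + integral {u..v} G = integral {a..v} G"
        using that G[of a v] by (intro Henstock_Kurzweil_Integration.integral_combine) auto
      then show ?thesis
        using that by (simp add: FG algebra_simps)
    qed
    have scale: "norm (X - h *\<^sub>R Y) \<le> e * h" if "0 < h" "norm (X /\<^sub>R h - Y) < e" for X Y :: 'b and h
    proof -
      have "X - h *\<^sub>R Y = h *\<^sub>R (X /\<^sub>R h - Y)"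
        using that(1) by (simp add: scaleR_diff_right)
      then show ?thesis
        using that by (simp add: mult.commute)
    qed
    let ?d = "min (min d1 d2) (min (b - t) (t - a))"
    show "\<exists>d>0. \<forall>y. norm (y - t) < d \<longrightarrow>
        norm (integral {a..y} F - integral {a..t} F - (y - t) *\<^sub>R F t) \<le> e * norm (y - t)"
    proof (intro exI[of _ ?d] conjI allI impI)
      show "0 < ?d"
        using d1 d2 t by auto
      fix y assume y: "norm (y - t) < ?d"
      consider "y = t" | "t < y" | "y < t" by linarith
      then show "norm (integral {a..y} F - integral {a..t} F - (y - t) *\<^sub>R F t) \<le> e * norm (y - t)"
      proof cases
        case 2
        then have "norm (integral {t..y} G - (y - t) *\<^sub>R G t) \<le> e * (y - t)"
          using scale[of "y - t"] d1(2)[of "y - t"] y by auto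
        then show ?thesis
          using diff[of t y] 2 y t by (simp add: Gt)
      next
        case 3
        have "integral {-t..-t + (t - y)} (\<lambda>t. G (- t)) = integral {y..t} G"
          using Henstock_Kurzweil_Integration.integral_reflect_real[of t y G] by simp
        then have "norm (integral {y..t} G - (t - y) *\<^sub>R G t) \<le> e * (t - y)"
          using scale[of "t - y"] d2(2)[of "t - y"] y 3 by auto
        moreover have "integral {a..y} F - integral {a..t} F - (y - t) *\<^sub>R F t =
            - (integral {y..t} G - (t - y) *\<^sub>R G t)"
          using diff[of y t] 3 y t by (simp add: Gt algebra_simps)
        ultimately show ?thesis
          using 3 by (simp only: norm_minus_cancel) simp
      qed simp
    qed
  qed
  then show ?thesis
    using N unfolding eventually_ae_filter_negligible by blast
qed

section \<open>Caratheodory right-hand sides\<close>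

text \<open>A normal form of the bounds in \<open>LC\<close> on one set: after passing to absolute
  values the bounds are nonnegative at every time, so their integrals are monotone in the
  interval.\<close>

definition caratheodory_bounds ::
  "('n::finite) rhs \<Rightarrow> ((real^'n) \<times> (real^'n)) set \<Rightarrow> (real \<Rightarrow> real) \<Rightarrow> (real \<Rightarrow> real) \<Rightarrow> bool" where
  "caratheodory_bounds f K m l \<longleftrightarrow>
    (\<forall>a b. m absolutely_integrable_on {a..b}) \<and> (\<forall>a b. l absolutely_integrable_on {a..b}) \<and>
    (\<forall>t. 0 \<le> m t) \<and> (\<forall>t. 0 \<le> l t) \<and>
    (AE t in lebesgue. \<forall>z\<in>K. norm (f t z) \<le> m t) \<and>
    (AE t in lebesgue. \<forall>z1\<in>K. \<forall>z2\<in>K. norm (f t z1 - f t z2) \<le> l t * norm (z1 - z2))"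

lemma caratheodory_boundsD:
  assumes "caratheodory_bounds f K m l"
  shows "m absolutely_integrable_on {a..b}" "l absolutely_integrable_on {a..b}" "0 \<le> m t" "0 \<le> l t"
    and "m integrable_on {a..b}" "l integrable_on {a..b}"
    and "AE t in lebesgue. \<forall>z\<in>K. norm (f t z) \<le> m t"
    and "AE t in lebesgue. \<forall>z1\<in>K. \<forall>z2\<in>K. norm (f t z1 - f t z2) \<le> l t * norm (z1 - z2)"
proof -
  show "m absolutely_integrable_on {a..b}" "l absolutely_integrable_on {a..b}"
    using assms by (simp_all add: caratheodory_bounds_def)
  then show "m integrable_on {a..b}" "l integrable_on {a..b}"
    by (simp_all add: set_lebesgue_integral_eq_integral(1))
qed (use assms in \<open>simp_all add: caratheodory_bounds_def\<close>)

lemma LC_boundsE: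
  fixes f :: "('n::finite) rhs"
  assumes "f \<in> LC" "compact K"
  obtains m l where "caratheodory_bounds f K m l"
proof -
  obtain m l where ml: "m \<in> L1_loc" "l \<in> L1_loc" "AE t in lebesgue.
          (\<forall>z\<in>K. norm (f t z) \<le> m t) \<and>
          (\<forall>z1\<in>K. \<forall>z2\<in>K. norm (f t z1 - f t z2) \<le> l t * norm (z1 - z2))"
    using assms unfolding LC_def by blast
  have m: "AE t in lebesgue. \<forall>z\<in>K. norm (f t z) \<le> \<bar>m t\<bar>"
    using ml(3) by eventually_elim force
  have l: "AE t in lebesgue. \<forall>z1\<in>K. \<forall>z2\<in>K. norm (f t z1 - f t z2) \<le> \<bar>l t\<bar> * norm (z1 - z2)"
    using ml(3)
  proof eventually_elim
    case (elim t)
    have "l t * norm (z1 - z2) \<le> \<bar>l t\<bar> * norm (z1 - z2)" for z1 z2 :: "(real^'n) \<times> (real^'n)"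
      by (simp add: mult_right_mono)
    with elim show ?case
      by (meson order_trans)
  qed
  have int: "(\<lambda>t. \<bar>m t\<bar>) absolutely_integrable_on {a..b}" "(\<lambda>t. \<bar>l t\<bar>) absolutely_integrable_on {a..b}" for a b
    using ml(1,2) unfolding L1_loc_def by (blast intro: set_integrable_abs)+
  show thesis
    by (rule that[of "\<lambda>t. \<bar>m t\<bar>" "\<lambda>t. \<bar>l t\<bar>"], unfold caratheodory_bounds_def)
      (intro conjI allI int m l abs_ge_zero)
qed

lemma LC_measurable: "f \<in> LC \<Longrightarrow> case_prod f \<in> borel_measurable borel"
  by (simp add: LC_def)

text \<open>Joint Borel measurability of the right-hand side makes the composition with a Borel
  curve measurable, and the bound on \<open>K\<close> dominates it. Allowing Borel curves covers the
  step functions used for the pointwise topology.\<close>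

lemma LC_integrable:
  assumes f: "f \<in> LC" and z: "z \<in> borel_measurable borel"
    and K: "compact K" "\<And>t. t \<in> {a..b} \<Longrightarrow> z t \<in> K"
  shows "(\<lambda>t. f t (z t)) absolutely_integrable_on {a..b}"
proof -
  obtain m l where ml: "caratheodory_bounds f K m l"
    by (rule LC_boundsE[OF f K(1)])
  have cf: "case_prod f \<in> borel_measurable borel"
    using f by (rule LC_measurable)
  have "(\<lambda>t. (t, z t)) \<in> borel_measurable borel"
    using z by (intro borel_measurable_Pair) auto
  from measurable_compose[OF this cf] have "(\<lambda>t. f t (z t)) \<in> borel_measurable borel"
    by simp
  then have "(\<lambda>t. f t (z t)) \<in> borel_measurable lborel"
    by simp
  then have "(\<lambda>t. f t (z t)) \<in> borel_measurable lebesgue"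
    by (rule measurable_completion)
  then have meas: "set_borel_measurable lebesgue {a..b} (\<lambda>t. f t (z t))"
    using borel_measurable_scaleR[of "indicator {a..b}" lebesgue]
    unfolding set_borel_measurable_def by (simp add: borel_measurable_indicator)
  show ?thesis
  proof (rule set_integrable_bound[OF caratheodory_boundsD(1)[OF ml] meas])
    show "AE t in lebesgue. t \<in> {a..b} \<longrightarrow> norm (f t (z t)) \<le> norm (m t)"
      using caratheodory_boundsD(7)[OF ml] proof eventually_elim
      case (elim t)
      have "norm (m t) = m t"
        using caratheodory_boundsD(3)[OF ml] by simp
      with elim K(2)[of t] show ?case
        by simp
    qed
  qed
qed

lemma LC_integrable_continuous:
  assumes f: "f \<in> LC" and z: "continuous_on {a..b} z"
  shows "(\<lambda>t. f t (z t)) absolutely_integrable_on {a..b}"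
proof -
  \<comment> \<open>Cutting off outside the interval turns a curve continuous only on
    \<open>{a..b}\<close> into a Borel function on the whole line.\<close>
  define z' where "z' t = indicator {a..b} t *\<^sub>R z t" for t
  have "(\<lambda>t. f t (z' t)) absolutely_integrable_on {a..b}"
  proof (rule LC_integrable[OF f])
    show "z' \<in> borel_measurable borel"
      unfolding z'_def using z by (intro borel_measurable_continuous_on_indicator) auto
    show "compact (z ` {a..b})"
      using z by (rule compact_continuous_image) simp
  qed (auto simp: z'_def)
  moreover have "(\<lambda>t. f t (z' t)) absolutely_integrable_on {a..b} \<longleftrightarrow>
      (\<lambda>t. f t (z t)) absolutely_integrable_on {a..b}"
    by (rule set_integrable_cong) (auto simp: z'_def)
  ultimately show ?thesis
    by simp
qed

text \<open>The seminorm estimates concern elements of \<open>LC\<close> and are applied to the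
  difference of an approximating right-hand side and the limit.\<close>

lemma LC_diff:
  assumes "f \<in> LC" "g \<in> LC"
  shows "(\<lambda>t z. f t z - g t z) \<in> LC"
proof -
  have "case_prod f \<in> borel_measurable borel" "case_prod g \<in> borel_measurable borel"
    using assms by (auto dest: LC_measurable)
  from borel_measurable_diff[OF this]
  have meas: "case_prod (\<lambda>t z. f t z - g t z) \<in> borel_measurable borel"
    by (simp add: split_def)
  have "\<exists>m\<in>L1_loc. \<exists>l\<in>L1_loc. AE t in lebesgue.
      (\<forall>z\<in>K. norm (f t z - g t z) \<le> m t) \<and>
      (\<forall>z1\<in>K. \<forall>z2\<in>K. norm (f t z1 - g t z1 - (f t z2 - g t z2)) \<le> l t * norm (z1 - z2))"
    if K: "compact K" for K
  proof -
    obtain m1 l1 where 1: "caratheodory_bounds f K m1 l1"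
      by (rule LC_boundsE[OF assms(1) K])
    obtain m2 l2 where 2: "caratheodory_bounds g K m2 l2"
      by (rule LC_boundsE[OF assms(2) K])
    show ?thesis
    proof (rule bexI[of _ "\<lambda>t. m1 t + m2 t"], rule bexI[of _ "\<lambda>t. l1 t + l2 t"])
      show "(\<lambda>t. m1 t + m2 t) \<in> L1_loc" "(\<lambda>t. l1 t + l2 t) \<in> L1_loc"
        unfolding L1_loc_def using caratheodory_boundsD(1,2)[OF 1] caratheodory_boundsD(1,2)[OF 2]
        by (simp_all add: set_integral_add(1))
      show "AE t in lebesgue. (\<forall>z\<in>K. norm (f t z - g t z) \<le> m1 t + m2 t) \<and>
        (\<forall>z1\<in>K. \<forall>z2\<in>K. norm (f t z1 - g t z1 - (f t z2 - g t z2)) \<le> (l1 t + l2 t) * norm (z1 - z2))"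
        using caratheodory_boundsD(7,8)[OF 1] caratheodory_boundsD(7,8)[OF 2]
      proof eventually_elim
        case (elim t)
        have "norm (f t z - g t z) \<le> m1 t + m2 t" if "z \<in> K" for z
          by (rule order_trans[OF norm_triangle_ineq4 add_mono]) (use elim(1,3) that in auto)
        moreover have "norm (f t z1 - g t z1 - (f t z2 - g t z2)) \<le> (l1 t + l2 t) * norm (z1 - z2)"
          if "z1 \<in> K" "z2 \<in> K" for z1 z2
        proof -
          have "norm (f t z1 - g t z1 - (f t z2 - g t z2)) =
              norm ((f t z1 - f t z2) - (g t z1 - g t z2))"
            by (simp add: algebra_simps)
          also have "\<dots> \<le> l1 t * norm (z1 - z2) + l2 t * norm (z1 - z2)"
            by (rule order_trans[OF norm_triangle_ineq4 add_mono]) (use elim(2,4) that in auto)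
          finally show ?thesis
            by (simp add: algebra_simps)
        qed
        ultimately show ?case by blast
      qed
    qed
  qed
  with meas show ?thesis
    unfolding LC_def by blast
qed

section \<open>The integral equation\<close>

definition history :: "(real \<Rightarrow> real^'n) \<Rightarrow> real \<Rightarrow> (real^'n) \<times> (real^'n)" where
  "history x t = (x t, x (t - 1))"

definition solution_upto ::
  "('n::finite) rhs \<Rightarrow> (real \<Rightarrow> real^'n) \<Rightarrow> real \<Rightarrow> (real \<Rightarrow> real^'n) \<Rightarrow> bool" where
  "solution_upto f \<phi> T x \<longleftrightarrow>
     continuous_on {- 1..T} x \<and> (\<forall>t\<in>{- 1..0}. x t = \<phi> t) \<and>
     (\<forall>t\<in>{0..T}. x t = \<phi> 0 + integral {0..t} (\<lambda>s. f s (history x s)))"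

text \<open>The crude factor 2 instead of the square root of 2 keeps radii natural: a curve in the
  ball of radius \<open>J\<close> has its history in the ball of radius \<open>2 * J\<close>, which
  is an admissible index for the optimal bounds.\<close>

lemma norm_history_le: "norm (x t) \<le> J \<Longrightarrow> norm (x (t - 1)) \<le> J \<Longrightarrow> norm (history x t) \<le> 2 * J"
  using norm_Pair_le[of "x t" "x (t - 1)"] by (simp add: history_def)

lemma norm_history_diff_le:
  "norm (x t - y s) \<le> J \<Longrightarrow> norm (x (t - 1) - y (s - 1)) \<le> J \<Longrightarrow> norm (history x t - history y s) \<le> 2 * J"
  using norm_Pair_le[of "x t - y s" "x (t - 1) - y (s - 1)"] by (simp add: history_def)

lemma continuous_on_history:
  assumes "continuous_on {- 1..T} x" "0 \<le> a" "b \<le> T"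
  shows "continuous_on {a..b} (history x)"
  unfolding history_def
  by (intro continuous_on_Pair continuous_on_subset[OF assms(1)] continuous_on_compose2[OF assms(1)]
      continuous_intros) (use assms in auto)

lemma integrable_along_history:
  assumes "f \<in> LC" "continuous_on {- 1..T} x" "0 \<le> a" "b \<le> T"
  shows "(\<lambda>s. f s (history x s)) absolutely_integrable_on {a..b}"
    and "(\<lambda>s. f s (history x s)) integrable_on {a..b}"
proof -
  show "(\<lambda>s. f s (history x s)) absolutely_integrable_on {a..b}"
    using assms(1) continuous_on_history[OF assms(2-4)] by (rule LC_integrable_continuous)
  then show "(\<lambda>s. f s (history x s)) integrable_on {a..b}"
    by (rule set_lebesgue_integral_eq_integral(1))
qed

lemma solution_upto_increment:
  assumes f: "f \<in> LC" and x: "solution_upto f \<phi> T x" and "0 \<le> s" "s \<le> t" "t \<le> T"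
  shows "x t - x s = integral {s..t} (\<lambda>u. f u (history x u))"
proof -
  have "continuous_on {- 1..T} x"
    using x by (simp add: solution_upto_def)
  then have "(\<lambda>u. f u (history x u)) integrable_on {0..t}"
    using integrable_along_history(2)[OF f] assms by blast
  then have "integral {0..s} (\<lambda>u. f u (history x u)) + integral {s..t} (\<lambda>u. f u (history x u)) =
      integral {0..t} (\<lambda>u. f u (history x u))"
    using assms by (intro Henstock_Kurzweil_Integration.integral_combine) auto
  moreover have "x t = \<phi> 0 + integral {0..t} (\<lambda>u. f u (history x u))"
    "x s = \<phi> 0 + integral {0..s} (\<lambda>u. f u (history x u))"
    using x assms unfolding solution_upto_def by auto
  ultimately show ?thesis
    by (simp add: algebra_simps)
qed

lemma solution_upto_mono: "solution_upto f \<phi> T x \<Longrightarrow> S \<le> T \<Longrightarrow> solution_upto f \<phi> S x"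
  unfolding solution_upto_def by (auto elim!: continuous_on_subset)

lemma solution_upto_cong:
  assumes "\<And>t. t \<in> {- 1..T} \<Longrightarrow> x t = y t" "0 \<le> T"
  shows "solution_upto f \<phi> T x \<longleftrightarrow> solution_upto f \<phi> T y"
proof -
  have "integral {0..t} (\<lambda>s. f s (history x s)) = integral {0..t} (\<lambda>s. f s (history y s))"
    if "t \<le> T" for t
    by (rule integral_cong) (use that assms in \<open>auto simp: history_def\<close>)
  moreover have "continuous_on {- 1..T} x \<longleftrightarrow> continuous_on {- 1..T} y"
    using assms by (intro continuous_on_cong) auto
  ultimately show ?thesis
    unfolding solution_upto_def using assms by auto
qed

text \<open>Absolute continuity is what allows the almost everywhere derivative to be integrated
  back to the increments of \<open>x\<close>.\<close>

lemma dde_solution_imp_solution_upto: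
  assumes x: "dde_solution f \<phi> b x" and T: "0 \<le> T" "ereal T < b"
  shows "solution_upto f \<phi> T x"
  unfolding solution_upto_def
proof (intro conjI ballI)
  have lt: "ereal t < b" if "t \<le> T" for t
    using that T(2) by (meson ereal_less_eq(3) order_le_less_trans)
  show "continuous_on {- 1..T} x"
    using x lt unfolding dde_solution_def by (auto elim!: continuous_on_subset)
  show "x t = \<phi> t" if "t \<in> {- 1..0}" for t
    using x that unfolding dde_solution_def by blast
  fix t assume t: "t \<in> {0..T}"
  have "((\<lambda>s. f s (history x s)) has_integral x t - x 0) {0..t}"
  proof (rule fundamental_theorem_of_calculus_absolutely_continuous)
    show "absolutely_continuous_on {0..t} x"
      using x t lt[of t] unfolding dde_solution_def by auto
    have "AE t in lebesgue. 0 < t \<and> ereal t < b \<longrightarrow>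
        (x has_vector_derivative f t (x t, x (t - 1))) (at t)"
      using x unfolding dde_solution_def by blast
    then show "AE s in lebesgue. 0 < s \<and> s < t \<longrightarrow> (x has_vector_derivative f s (history x s)) (at s)"
      by eventually_elim (use t lt in \<open>auto simp: history_def\<close>)
  qed (use t in auto)
  moreover have "x 0 = \<phi> 0"
    using x unfolding dde_solution_def by simp
  ultimately show "x t = \<phi> 0 + integral {0..t} (\<lambda>s. f s (history x s))"
    by (simp add: integral_unique)
qed

text \<open>All requirements are local in time, so each is checked on some \<open>{- 1..T}\<close>
  with \<open>T\<close> below \<open>b\<close>; the value of \<open>b\<close> may be
  infinite.\<close>

lemma solution_upto_imp_dde_solution:
  assumes f: "f \<in> LC" and "0 < b"
    and x: "\<And>T. 0 \<le> T \<Longrightarrow> ereal T < b \<Longrightarrow> solution_upto f \<phi> T x"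
  shows "dde_solution f \<phi> b x"
  unfolding dde_solution_def
proof (intro conjI allI impI)
  have cont: "continuous_on {- 1..T} x" if "0 \<le> T" "ereal T < b" for T
    using x[OF that] by (simp add: solution_upto_def)
  show "0 < b" by fact
  show "continuous_on {t. - 1 \<le> t \<and> ereal t < b} x"
    unfolding continuous_on_eq_continuous_within
  proof
    fix t assume "t \<in> {t. - 1 \<le> t \<and> ereal t < b}"
    then have t: "- 1 \<le> t" "max 0 (ereal t) < b"
      using \<open>0 < b\<close> by auto
    then obtain T where T: "max 0 (ereal t) < ereal T" "ereal T < b"
      using ereal_dense2 by blast
    then have T0: "0 < T" "t < T"
      by auto
    \<comment> \<open>Near \<open>t\<close> the half-open domain and the compact interval coincide
      because \<open>T\<close> lies strictly beyond \<open>t\<close>.\<close>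
    have "at t within {t. - 1 \<le> t \<and> ereal t < b} = at t within {- 1..T}"
    proof (rule at_within_nhd[of t "{..<T}"])
      show "{t. - 1 \<le> t \<and> ereal t < b} \<inter> {..<T} - {t} = {- 1..T} \<inter> {..<T} - {t}"
        using T(2) by (auto intro: less_trans[of _ "ereal T"])
    qed (use T0 in auto)
    moreover have "continuous (at t within {- 1..T}) x"
      using cont[of T] T T0 t unfolding continuous_on_eq_continuous_within by auto
    ultimately show "continuous (at t within {t. - 1 \<le> t \<and> ereal t < b}) x"
      by simp
  qed
  show "\<forall>t\<in>{- 1..0}. x t = \<phi> t"
    using x[of 0] \<open>0 < b\<close> by (simp add: solution_upto_def zero_ereal_def)
  show "absolutely_continuous_on {0..T} x" if "0 \<le> T \<and> ereal T < b" for T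
    by (rule absolutely_continuous_on_indefinite_integral[OF integrable_along_history(1)[OF f]])
      (use x[of T] that in \<open>auto simp: solution_upto_def\<close>)
  have ae: "AE t in lebesgue. 0 < t \<and> t < T \<longrightarrow> (x has_vector_derivative f t (history x t)) (at t)"
    if "0 < T" "ereal T < b" for T
  proof -
    have "(\<lambda>s. f s (history x s)) absolutely_integrable_on {0..T}"
      using integrable_along_history(1)[OF f cont[of T], of 0 T] that by simp
    from indefinite_integral_has_vector_derivative_AE[OF this] show ?thesis
    proof eventually_elim
      case (elim t)
      show ?case
      proof
        assume t: "0 < t \<and> t < T"
        then have "((\<lambda>t. \<phi> 0 + integral {0..t} (\<lambda>s. f s (history x s))) has_vector_derivative
            f t (history x t)) (at t)"
          using has_vector_derivative_add[OF has_vector_derivative_const elim[rule_format, OF t]] by simp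
        then show "(x has_vector_derivative f t (history x t)) (at t)"
          by (rule has_vector_derivative_transform_within_open[of _ _ _ "{0<..<T}"])
            (use t x[of T] that in \<open>auto simp: solution_upto_def\<close>)
      qed
    qed
  qed
  \<comment> \<open>The exceptional null set depends on the right endpoint, so only countably many
    endpoints may be used; the rational ones below \<open>b\<close> exhaust the domain.\<close>
  have "AE t in lebesgue. \<forall>q::rat. 0 < real_of_rat q \<and> ereal (real_of_rat q) < b \<longrightarrow>
      0 < t \<and> t < real_of_rat q \<longrightarrow> (x has_vector_derivative f t (history x t)) (at t)"
    using ae by (subst AE_all_countable) (auto simp: AE_conj_iff)
  then show "AE t in lebesgue. 0 < t \<and> ereal t < b \<longrightarrow>
      (x has_vector_derivative f t (x t, x (t - 1))) (at t)"
  proof eventually_elim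
    case (elim t)
    show ?case
    proof
      assume t: "0 < t \<and> ereal t < b"
      then obtain T where T: "t < T" "ereal T < b"
        using ereal_dense2[of "ereal t" b] by auto
      obtain q where q: "t < real_of_rat q" "real_of_rat q < T"
        using of_rat_dense[OF T(1)] by blast
      then have "ereal (real_of_rat q) < b"
        using T(2) by (auto intro: less_trans[of _ "ereal T"])
      then show "(x has_vector_derivative f t (x t, x (t - 1))) (at t)"
        using elim[rule_format, of q] q t
        by (simp add: history_def del: zero_less_of_rat_iff)
    qed
  qed
qed

section \<open>Propagation over short time steps and uniqueness\<close>

text \<open>Equal pieces shorter than \<open>d\<close> reach \<open>T\<close> in finitely many
  steps. This takes the place of a Gronwall inequality.\<close>

lemma small_step_induct:
  fixes T d :: real
  assumes "0 < d" "0 \<le> T" "P 0"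
    and step: "\<And>s t. 0 \<le> s \<Longrightarrow> s \<le> t \<Longrightarrow> t \<le> T \<Longrightarrow> t - s < d \<Longrightarrow> P s \<Longrightarrow> P t"
  shows "P T"
proof -
  obtain n where n: "T / d < real n"
    using reals_Archimedean2 by blast
  then have "0 < real n"
    using assms by (meson divide_nonneg_pos order_le_less_trans)
  have P: "P (real k * (T / real n))" if "k \<le> n" for k
    using that
  proof (induction k)
    case (Suc k)
    then have "P (real k * (T / real n))"
      by simp
    then show ?case
    proof (rule step[rotated -1])
      have "real (Suc k) * (T / real n) \<le> real n * (T / real n)"
        using Suc.prems \<open>0 \<le> T\<close> by (intro mult_right_mono) auto
      then show "real (Suc k) * (T / real n) \<le> T"
        using \<open>0 < real n\<close> by simp
      have "T / real n < d"
        using n \<open>0 < d\<close> \<open>0 < real n\<close> by (simp add: field_simps)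
      then show "real (Suc k) * (T / real n) - real k * (T / real n) < d"
        by (simp only: of_nat_Suc distrib_right)
      show "real k * (T / real n) \<le> real (Suc k) * (T / real n)"
        using \<open>0 \<le> T\<close> by (intro mult_right_mono) auto
    qed (use \<open>0 \<le> T\<close> in auto)
  qed (use assms in simp)
  show ?thesis
    using P[of n] \<open>0 < real n\<close> by simp
qed

text \<open>Let \<open>M\<close> be the maximum of the distance over all of \<open>{- 1..t}\<close>,
  delayed times included. If it is attained up to time \<open>s\<close>, it is at most
  \<open>D\<close>. Otherwise the Lipschitz term contributes at most 1/4 times \<open>2 * M\<close>,
  so \<open>M\<close> is at most \<open>D + M / 2\<close>.\<close>

lemma lipschitz_step:
  assumes K: "caratheodory_bounds f K m l"
    and int: "(\<lambda>u. f u (history y u) - f u (history x u)) integrable_on {s..t}"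
    and cont: "continuous_on {- 1..t} x" "continuous_on {- 1..t} y"
    and st: "0 \<le> s" "s \<le> t"
    and inK: "\<And>r. r \<in> {s..t} \<Longrightarrow> history x r \<in> K \<and> history y r \<in> K"
    and l: "integral {s..t} l \<le> 1 / 4"
    and before: "\<And>r. r \<in> {- 1..s} \<Longrightarrow> norm (y r - x r) \<le> D"
    and after: "\<And>r. r \<in> {s..t} \<Longrightarrow>
      norm (y r - x r) \<le> D + norm (integral {s..r} (\<lambda>u. f u (history y u) - f u (history x u)))"
    and r: "r \<in> {- 1..t}"
  shows "norm (y r - x r) \<le> 2 * D"
proof -
  obtain r0 where r0: "r0 \<in> {- 1..t}" "\<And>r. r \<in> {- 1..t} \<Longrightarrow> norm (y r - x r) \<le> norm (y r0 - x r0)"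
  proof -
    have "continuous_on {- 1..t} (\<lambda>r. norm (y r - x r))"
      by (intro continuous_intros cont)
    moreover have "{- 1..t} \<noteq> {}"
      using st by simp
    ultimately show thesis
      using continuous_attains_sup[of "{- 1..t}" "\<lambda>r. norm (y r - x r)"] that by blast
  qed
  define M where "M = norm (y r0 - x r0)"
  have "0 \<le> M"
    by (simp add: M_def)
  have "0 \<le> D"
    using before[of s] st norm_ge_zero order_trans by (metis atLeastAtMost_iff le_minus_one_simps(1) order_refl)
  have "M \<le> 2 * D"
  proof (cases "r0 \<le> s")
    case True
    then show ?thesis
      using before[of r0] r0 \<open>0 \<le> D\<close> by (auto simp: M_def)
  next
    case False
    have "norm (integral {s..r0} (\<lambda>u. f u (history y u) - f u (history x u))) \<le>
        integral {s..r0} (\<lambda>u. l u * (2 * M))"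
    proof (rule integral_norm_bound_AE)
      show "(\<lambda>u. f u (history y u) - f u (history x u)) integrable_on {s..r0}"
        using integrable_on_subinterval[OF int, of s r0] r0 by auto
      show "(\<lambda>u. l u * (2 * M)) integrable_on {s..r0}"
        using caratheodory_boundsD(6)[OF K] by (rule integrable_on_mult_left)
      show "AE u in lebesgue. u \<in> {s..r0} \<longrightarrow> norm (f u (history y u) - f u (history x u)) \<le> l u * (2 * M)"
        using caratheodory_boundsD(8)[OF K]
      proof eventually_elim
        case (elim u)
        show ?case
        proof
          assume u: "u \<in> {s..r0}"
          then have "norm (f u (history y u) - f u (history x u)) \<le> l u * norm (history y u - history x u)"
            using elim inK[of u] r0 by auto
          also have "\<dots> \<le> l u * (2 * M)"
            by (intro mult_left_mono norm_history_diff_le caratheodory_boundsD(4)[OF K])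
              (use r0 u st in \<open>auto simp: M_def\<close>)
          finally show "norm (f u (history y u) - f u (history x u)) \<le> l u * (2 * M)" .
        qed
      qed
    qed
    also have "\<dots> = integral {s..r0} l * (2 * M)"
      by simp
    also have "\<dots> \<le> 1 / 4 * (2 * M)"
    proof (intro mult_right_mono)
      have "integral {s..r0} l \<le> integral {s..t} l"
        by (rule integral_subset_le) (use r0 caratheodory_boundsD[OF K] in auto)
      then show "integral {s..r0} l \<le> 1 / 4"
        using l by simp
    qed (use \<open>0 \<le> M\<close> in simp)
    finally show ?thesis
      using after[of r0] False r0 by (simp add: M_def)
  qed
  then show ?thesis
    using r0(2)[OF r] by (simp add: M_def)
qed

text \<open>This is \<open>lipschitz_step\<close> with \<open>D = 0\<close>: agreement up to
  \<open>s\<close> forces agreement a fixed step further.\<close>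

lemma solution_upto_unique:
  assumes f: "f \<in> LC" and x: "solution_upto f \<phi> T x" and y: "solution_upto f \<phi> T y"
    and T: "0 \<le> T" and r: "r \<in> {- 1..T}"
  shows "y r = x r"
proof -
  have cont: "continuous_on {- 1..T} x" "continuous_on {- 1..T} y"
    using x y by (simp_all add: solution_upto_def)
  \<comment> \<open>The union of the two compact orbits yields one Lipschitz bound that compares
    them with each other.\<close>
  define K where "K = history x ` {0..T} \<union> history y ` {0..T}"
  have "compact K"
    unfolding K_def using cont by (intro compact_Un compact_continuous_image continuous_on_history) auto
  then obtain m l where K: "caratheodory_bounds f K m l"
    by (rule LC_boundsE[OF f])
  obtain d where d: "0 < d" "\<And>s t. 0 \<le> s \<Longrightarrow> t \<le> T \<Longrightarrow> t - s < d \<Longrightarrow> integral {s..t} l < 1 / 4"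
    by (rule integral_small_on_short_intervals[where h = l and a = 0 and b = T and e = "1 / 4"])
      (use caratheodory_boundsD[OF K] in auto)
  have "\<forall>r\<in>{- 1..T}. norm (y r - x r) \<le> 0"
  proof (rule small_step_induct[OF d(1) T])
    show "\<forall>r\<in>{- 1..0}. norm (y r - x r) \<le> 0"
      using x y by (simp add: solution_upto_def)
    fix s t assume st: "0 \<le> s" "s \<le> t" "t \<le> T" "t - s < d" and IH: "\<forall>r\<in>{- 1..s}. norm (y r - x r) \<le> 0"
    have int: "(\<lambda>u. f u (history x u)) integrable_on {s..r}" "(\<lambda>u. f u (history y u)) integrable_on {s..r}"
      if "r \<le> T" for r
      using integrable_along_history(2)[OF f] cont st that by blast+
    show "\<forall>r\<in>{- 1..t}. norm (y r - x r) \<le> 0"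
    proof
      fix r assume r: "r \<in> {- 1..t}"
      have "norm (y r - x r) \<le> 2 * 0"
      proof (rule lipschitz_step[OF K _ _ _ st(1,2) _ _ _ _ r])
        show "(\<lambda>u. f u (history y u) - f u (history x u)) integrable_on {s..t}"
          using int st by (auto intro!: integrable_diff)
        show "continuous_on {- 1..t} x" "continuous_on {- 1..t} y"
          using cont st by (auto elim!: continuous_on_subset)
        show "history x r \<in> K \<and> history y r \<in> K" if "r \<in> {s..t}" for r
          using that st by (auto simp: K_def)
        show "integral {s..t} l \<le> 1 / 4"
          using d(2)[of s t] st by simp
        show "norm (y r - x r) \<le> 0" if "r \<in> {- 1..s}" for r
          using IH that by blast
        show "norm (y r - x r) \<le> 0 + norm (integral {s..r} (\<lambda>u. f u (history y u) - f u (history x u)))"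
          if r: "r \<in> {s..t}" for r
        proof -
          have "y s = x s"
            using IH st by simp
          then have "y r - x r = (y r - y s) - (x r - x s)"
            by simp
          also have "\<dots> = integral {s..r} (\<lambda>u. f u (history y u)) - integral {s..r} (\<lambda>u. f u (history x u))"
            using solution_upto_increment[OF f x, of s r] solution_upto_increment[OF f y, of s r] r st by simp
          also have "\<dots> = integral {s..r} (\<lambda>u. f u (history y u) - f u (history x u))"
            using int[of r] r st by (simp add: integral_diff)
          finally show ?thesis by simp
        qed
      qed
      then show "norm (y r - x r) \<le> 0" by simp
    qed
  qed
  then show ?thesis
    using r by simp
qed

section \<open>Existence and blow-up of maximal solutions\<close>

text \<open>Over a step of length at most 1 the delayed argument is already known, so the problem is
  an ordinary differential equation, solved by Banach's fixed point theorem. The step depends only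
  on \<open>J\<close> and \<open>T'\<close>, and this uniformity is what later carries a bounded
  solution past the end of its interval.\<close>

lemma local_extension:
  fixes f :: "('n::finite) rhs"
  assumes f: "f \<in> LC" and J: "0 \<le> J"
  shows "\<exists>\<delta>>0. \<forall>T \<phi> x. 0 \<le> T \<and> T \<le> T' \<and> solution_upto f \<phi> T x \<and> (\<forall>t\<in>{- 1..T}. norm (x t) \<le> J) \<longrightarrow>
      (\<exists>y. solution_upto f \<phi> (T + \<delta>) y)"
proof -
  \<comment> \<open>The new value stays within distance 1 of \<open>x T\<close>, hence below
    \<open>J + 1\<close>, and the delayed one is below \<open>J\<close>.\<close>
  define K :: "((real^'n) \<times> (real^'n)) set" where "K = cball 0 (2 * (J + 1))"
  have "compact K"
    by (simp add: K_def)
  then obtain m l where K: "caratheodory_bounds f K m l"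
    by (rule LC_boundsE[OF f])
  obtain d1 where d1: "0 < d1" "\<And>s t. 0 \<le> s \<Longrightarrow> t \<le> T' + 1 \<Longrightarrow> t - s < d1 \<Longrightarrow> integral {s..t} m < 1"
    by (rule integral_small_on_short_intervals[where h = m and a = 0 and b = "T' + 1" and e = 1])
      (use caratheodory_boundsD[OF K] in auto)
  obtain d2 where d2: "0 < d2" "\<And>s t. 0 \<le> s \<Longrightarrow> t \<le> T' + 1 \<Longrightarrow> t - s < d2 \<Longrightarrow> integral {s..t} l < 1 / 2"
    by (rule integral_small_on_short_intervals[where h = l and a = 0 and b = "T' + 1" and e = "1 / 2"])
      (use caratheodory_boundsD[OF K] in auto)
  \<comment> \<open>The bound 1 keeps the delayed time in the past, \<open>d1\<close> keeps iterates
    within distance 1 of \<open>x T\<close>, \<open>d2\<close> makes the operator a contraction, and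
    halving gives strict inequalities.\<close>
  define \<delta> where "\<delta> = min 1 (min d1 d2 / 2)"
  have \<delta>: "0 < \<delta>" "\<delta> \<le> 1" "\<delta> < d1" "\<delta> < d2"
    using d1(1) d2(1) by (auto simp: \<delta>_def min_def)
  have "\<exists>y. solution_upto f \<phi> (T + \<delta>) y"
    if T: "0 \<le> T" "T \<le> T'" and x: "solution_upto f \<phi> T x" and xJ: "\<And>t. t \<in> {- 1..T} \<Longrightarrow> norm (x t) \<le> J"
    for T \<phi> x
  proof -
    define c where "c = T + \<delta>"
    have contx: "continuous_on {- 1..T} x"
      using x by (simp add: solution_upto_def)
    define S where "S = cball (const_bcontfun (x T) :: real \<Rightarrow>\<^sub>C (real^'n)) 1"
    define z where "z y s = (apply_bcontfun y s, x (s - 1))" for y :: "real \<Rightarrow>\<^sub>C (real^'n)" and s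
    have S: "dist (apply_bcontfun y s) (x T) \<le> 1" if "y \<in> S" for y s
      using that dist_bounded[of "const_bcontfun (x T)" s y]
      by (auto simp: S_def dist_commute const_bcontfun.rep_eq intro: order_trans)
    have zK: "z y s \<in> K" if "y \<in> S" "s \<in> {T..c}" for y s
    proof -
      have "norm (x T) \<le> J" "norm (x (s - 1)) \<le> J"
        using xJ[of T] xJ[of "s - 1"] that T \<delta> by (auto simp: c_def)
      moreover have "norm (apply_bcontfun y s) \<le> norm (x T) + 1"
        using S[OF that(1), of s] norm_triangle_sub[of "apply_bcontfun y s" "x T"] by (simp add: dist_norm)
      ultimately have "norm (z y s) \<le> (J + 1) + J"
        using norm_Pair_le[of "apply_bcontfun y s" "x (s - 1)"] by (simp add: z_def)
      then show ?thesis
        using J by (simp add: K_def)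
    qed
    have contz: "continuous_on {T..c} (z y)" for y
      unfolding z_def
      by (intro continuous_on_Pair continuous_on_apply_bcontfun continuous_on_compose2[OF contx] continuous_intros)
        (use T \<delta> in \<open>auto simp: c_def\<close>)
    have int: "(\<lambda>s. f s (z y s)) integrable_on {T..t}" if "t \<le> c" for y t
      using LC_integrable_continuous[OF f continuous_on_subset[OF contz]] that
      by (intro set_lebesgue_integral_eq_integral(1)) auto
    \<comment> \<open>The complete space at hand consists of bounded continuous functions on the
      whole line; freezing time outside \<open>{T..c}\<close> makes the integral operator act on
      it.\<close>
    define clamp where "clamp t = max T (min c t)" for t
    have clamp: "clamp t \<in> {T..c}" for t
      using \<delta> by (auto simp: clamp_def c_def)
    define G where "G y t = x T + integral {T..clamp t} (\<lambda>s. f s (z y s))" for y t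
    have small: "norm (integral {T..t} (\<lambda>s. f s (z y s))) \<le> 1" if "y \<in> S" "t \<in> {T..c}" for y t
    proof -
      have "norm (integral {T..t} (\<lambda>s. f s (z y s))) \<le> integral {T..t} m"
      proof (rule integral_norm_bound_AE[OF int caratheodory_boundsD(5)[OF K]])
        show "AE s in lebesgue. s \<in> {T..t} \<longrightarrow> norm (f s (z y s)) \<le> m s"
          using caratheodory_boundsD(7)[OF K] by eventually_elim (use zK[OF that(1)] that(2) in auto)
      qed (use that in simp)
      also have "\<dots> < 1"
        using d1(2)[of T t] T that \<delta> by (simp add: c_def)
      finally show ?thesis by simp
    qed
    have contG: "continuous_on UNIV (G y)" for y
    proof -
      have "continuous_on {T..c} (\<lambda>t. integral {T..t} (\<lambda>s. f s (z y s)))"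
        using int[of c] by (intro indefinite_integral_continuous_1) simp
      then have "continuous_on UNIV (\<lambda>t. integral {T..clamp t} (\<lambda>s. f s (z y s)))"
        by (rule continuous_on_compose2[of "{T..c}" _ _ clamp])
          (use clamp in \<open>auto simp: clamp_def intro!: continuous_intros\<close>)
      then show ?thesis
        unfolding G_def by (intro continuous_intros)
    qed
    have GS: "dist (G y t) (x T) \<le> 1" if "y \<in> S" for y t
      using small[OF that clamp[of t]] by (simp add: G_def dist_norm)
    have Gb: "G y \<in> bcontfun" if "y \<in> S" for y
    proof (rule bcontfun_normI[OF contG])
      show "norm (G y t) \<le> norm (x T) + 1" for t
        using GS[OF that, of t] norm_triangle_sub[of "G y t" "x T"] by (simp add: dist_norm)
    qed
    have app: "apply_bcontfun (Bcontfun (G y)) = G y" if "y \<in> S" for y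
      using Gb[OF that] by (rule Bcontfun_inverse)
    have "\<exists>!y\<in>S. Bcontfun (G y) = y"
    proof (rule Banach_fix[where c = "1 / 2"])
      show "complete S"
        unfolding S_def by (simp add: complete_eq_closed)
      show "S \<noteq> {}"
        by (simp add: S_def)
      show "(\<lambda>y. Bcontfun (G y)) ` S \<subseteq> S"
      proof (rule image_subsetI)
        fix y assume y: "y \<in> S"
        have "dist (const_bcontfun (x T)) (Bcontfun (G y)) \<le> 1"
          by (rule dist_bound) (use GS[OF y] in \<open>simp add: app[OF y] const_bcontfun.rep_eq dist_commute\<close>)
        then show "Bcontfun (G y) \<in> S"
          by (simp add: S_def)
      qed
      fix y w assume y: "y \<in> S" and w: "w \<in> S"
      have zd: "norm (z y s - z w s) \<le> dist y w" for s
        using dist_bounded[of y s w] by (simp add: z_def norm_Pair dist_norm)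
      have *: "dist (G y t) (G w t) \<le> 1 / 2 * dist y w" for t
      proof -
        let ?c = "clamp t"
        have ints: "(\<lambda>s. f s (z y s)) integrable_on {T..?c}" "(\<lambda>s. f s (z w s)) integrable_on {T..?c}"
          using int clamp[of t] by auto
        then have "dist (G y t) (G w t) = norm (integral {T..?c} (\<lambda>s. f s (z y s) - f s (z w s)))"
          by (simp add: G_def dist_norm integral_diff)
        also have "\<dots> \<le> integral {T..?c} (\<lambda>s. l s * dist y w)"
        proof (rule integral_norm_bound_AE)
          show "(\<lambda>s. f s (z y s) - f s (z w s)) integrable_on {T..?c}"
            using ints by (rule integrable_diff)
          show "(\<lambda>s. l s * dist y w) integrable_on {T..?c}"
            using caratheodory_boundsD(6)[OF K] by (rule integrable_on_mult_left)
          show "AE s in lebesgue. s \<in> {T..?c} \<longrightarrow> norm (f s (z y s) - f s (z w s)) \<le> l s * dist y w"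
            using caratheodory_boundsD(8)[OF K]
          proof eventually_elim
            case (elim s)
            show ?case
            proof
              assume "s \<in> {T..?c}"
              then have "s \<in> {T..c}"
                using clamp[of t] by auto
              then have "norm (f s (z y s) - f s (z w s)) \<le> l s * norm (z y s - z w s)"
                using elim zK y w by blast
              also have "\<dots> \<le> l s * dist y w"
                by (intro mult_left_mono zd caratheodory_boundsD(4)[OF K])
              finally show "norm (f s (z y s) - f s (z w s)) \<le> l s * dist y w" .
            qed
          qed
        qed
        also have "\<dots> = integral {T..?c} l * dist y w"
          by simp
        also have "\<dots> \<le> 1 / 2 * dist y w"
        proof (rule mult_right_mono)
          show "integral {T..?c} l \<le> 1 / 2"
            using d2(2)[of T ?c] T clamp[of t] \<delta> by (simp add: c_def)
        qed simp
        finally show ?thesis .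
      qed
      show "dist (Bcontfun (G y)) (Bcontfun (G w)) \<le> 1 / 2 * dist y w"
        by (rule dist_bound) (use * in \<open>simp add: app y w\<close>)
    qed auto
    then obtain y where y: "y \<in> S" "Bcontfun (G y) = y"
      by blast
    then have yG: "apply_bcontfun y t = G y t" for t
      using app[OF y(1)] by simp
    define w where "w t = (if t \<le> T then x t else apply_bcontfun y t)" for t
    have yT: "apply_bcontfun y T = x T"
      using \<delta> by (simp add: yG G_def clamp_def c_def)
    have wy: "w t = apply_bcontfun y t" if "T \<le> t" for t
      using that yT by (auto simp: w_def)
    have wx: "w t = x t" if "t \<le> T" for t
      using that by (simp add: w_def)
    have contw: "continuous_on {- 1..c} w"
    proof -
      have "continuous_on ({- 1..T} \<union> {T..c}) w"
      proof (rule continuous_on_closed_Un)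
        show "continuous_on {- 1..T} w"
          using contx by (rule continuous_on_eq) (simp add: wx)
        show "continuous_on {T..c} w"
          by (rule continuous_on_eq[OF continuous_on_apply_bcontfun[of _ y]]) (simp add: wy)
      qed auto
      moreover have "{- 1..T} \<union> {T..c} = {- 1..c}"
        using T \<delta> by (auto simp: c_def)
      ultimately show ?thesis by simp
    qed
    have wsol: "solution_upto f \<phi> T w"
      using x solution_upto_cong[of T w x f \<phi>] T wx by auto
    have "w t = \<phi> 0 + integral {0..t} (\<lambda>s. f s (history w s))" if "t \<in> {0..c}" for t
    proof (cases "t \<le> T")
      case True
      then show ?thesis
        using wsol that by (auto simp: solution_upto_def)
    next
      case False
      then have t: "t \<in> {T..c}"
        using that by simp
      have "w t = w T + integral {T..t} (\<lambda>s. f s (z y s))"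
        using t wx[of T] wy[of t] yG[of t] by (simp add: G_def clamp_def max_absorb2 min_absorb2)
      also have "integral {T..t} (\<lambda>s. f s (z y s)) = integral {T..t} (\<lambda>s. f s (history w s))"
        by (rule integral_cong) (use t \<delta> in \<open>auto simp: z_def history_def wy wx c_def\<close>)
      also have "w T = \<phi> 0 + integral {0..T} (\<lambda>s. f s (history w s))"
        using wsol T by (simp add: solution_upto_def)
      also have "\<dots> + integral {T..t} (\<lambda>s. f s (history w s)) = \<phi> 0 + integral {0..t} (\<lambda>s. f s (history w s))"
        using Henstock_Kurzweil_Integration.integral_combine[of 0 T t "\<lambda>s. f s (history w s)"]
          integrable_along_history(2)[OF f contw, of 0 t] T t by auto
      finally show ?thesis .
    qed
    then have "solution_upto f \<phi> c w"
      using contw wsol T by (simp add: solution_upto_def)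
    then show ?thesis
      unfolding c_def by blast
  qed
  then show ?thesis
    using \<delta>(1) by (intro exI[of _ \<delta>] conjI allI impI) (simp, blast)
qed

text \<open>The end of the interval is the supremum of all times reached by some solution, and
  uniqueness glues these solutions together.\<close>

lemma ex_maximal_dde_solution:
  assumes f: "f \<in> LC" and \<phi>: "continuous_on {- 1..0} \<phi>"
  shows "\<exists>b x. maximal_dde_solution f \<phi> b x"
proof -
  define A where "A = {T. 0 \<le> T \<and> (\<exists>y. solution_upto f \<phi> T y)}"
  define b where "b = Sup (ereal ` A)"
  \<comment> \<open>The value at \<open>t\<close> is read off from an arbitrary solution reaching
    \<open>t\<close>; by uniqueness it does not depend on the choice. The \<open>max\<close> covers
    times in the initial interval.\<close>
  define x where "x t = (SOME y. solution_upto f \<phi> (max 0 t) y) t" for t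
  have x: "solution_upto f \<phi> T x" if y: "solution_upto f \<phi> T y" and T: "0 \<le> T" for T y
  proof -
    have "x t = y t" if t: "t \<in> {- 1..T}" for t
    proof -
      define w where "w = (SOME y. solution_upto f \<phi> (max 0 t) y)"
      have yt: "solution_upto f \<phi> (max 0 t) y"
        using y t T by (intro solution_upto_mono[OF y]) auto
      then have "solution_upto f \<phi> (max 0 t) w"
        unfolding w_def by (rule someI[of "solution_upto f \<phi> (max 0 t)"])
      then have "w t = y t"
        by (rule solution_upto_unique[OF f yt]) (use t in auto)
      then show ?thesis
        by (simp add: x_def w_def)
    qed
    then show ?thesis
      using y solution_upto_cong[of T x y f \<phi>] T by blast
  qed
  have sol0: "solution_upto f \<phi> 0 \<phi>"
    using \<phi> by (simp add: solution_upto_def)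
  have "bounded (\<phi> ` {- 1..0})"
    using \<phi> by (intro compact_imp_bounded compact_continuous_image) auto
  then obtain J where J: "0 < J" "\<forall>t\<in>{- 1..0}. norm (\<phi> t) \<le> J"
    unfolding bounded_pos by auto
  \<comment> \<open>The initial function is itself a solution up to time 0; extending it shows that
    \<open>b\<close> is positive.\<close>
  from local_extension[OF f less_imp_le[OF J(1)], of 0]
  obtain \<delta> where "0 < \<delta>" and \<delta>: "\<forall>T \<phi> x. 0 \<le> T \<and> T \<le> 0 \<and> solution_upto f \<phi> T x \<and>
      (\<forall>t\<in>{- 1..T}. norm (x t) \<le> J) \<longrightarrow> (\<exists>y. solution_upto f \<phi> (T + \<delta>) y)"
    by (elim exE conjE)
  have "\<exists>y. solution_upto f \<phi> (0 + \<delta>) y"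
    by (rule \<delta>[rule_format, of 0 \<phi> \<phi>]) (use sol0 J(2) in auto)
  with \<open>0 < \<delta>\<close> have "\<delta> \<in> A"
    by (auto simp: A_def)
  then have "ereal \<delta> \<le> b"
    unfolding b_def by (intro Sup_upper) auto
  with \<open>0 < \<delta>\<close> have "0 < b"
    by (auto intro: less_le_trans[of _ "ereal \<delta>"])
  have "dde_solution f \<phi> b x"
  proof (rule solution_upto_imp_dde_solution[OF f \<open>0 < b\<close>])
    fix T :: real assume T: "0 \<le> T" "ereal T < b"
    then obtain S where "S \<in> A" "T < S"
      unfolding b_def less_Sup_iff by auto
    then have "solution_upto f \<phi> S x"
      using x by (auto simp: A_def)
    then show "solution_upto f \<phi> T x"
      using \<open>T < S\<close> by (auto intro: solution_upto_mono)
  qed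
  moreover have "c = b" if "dde_solution f \<phi> c y" "b \<le> c" for c y
  proof (rule ccontr)
    assume "c \<noteq> b"
    with that have "b < c" by simp
    then obtain T where T: "b < ereal T" "ereal T < c"
      using ereal_dense2 by blast
    then have "0 < ereal T"
      using \<open>0 < b\<close> by (meson less_trans)
    then have "0 \<le> T" by simp
    then have "T \<in> A"
      using dde_solution_imp_solution_upto[OF that(1)] T(2) by (auto simp: A_def)
    then have "ereal T \<le> b"
      unfolding b_def by (intro Sup_upper) auto
    with T(1) show False by simp
  qed
  ultimately show ?thesis
    unfolding maximal_dde_solution_def by blast
qed

text \<open>If the solution stayed bounded up to a finite end, the uniform step of
  \<open>local_extension\<close>, started close enough to the end, would cross it and contradict
  maximality.\<close>

lemma maximal_dde_solution_unbounded:
  assumes f: "f \<in> LC" and x: "maximal_dde_solution f \<phi> b x" and b: "b \<le> ereal T'"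
  shows "\<exists>t. - 1 \<le> t \<and> ereal t < b \<and> J < norm (x t)"
proof (rule ccontr)
  assume *: "\<not> ?thesis"
  have dde: "dde_solution f \<phi> b x"
    using x by (simp add: maximal_dde_solution_def)
  then have "0 < b"
    by (simp add: dde_solution_def)
  then obtain B where B: "b = ereal B" "0 < B" "B \<le> T'"
    using b by (cases b) auto
  have xJ: "norm (x t) \<le> J" if "- 1 \<le> t" "t < B" for t
    using * that by (auto simp: B not_less)
  have "0 \<le> J"
    using xJ[of 0] B norm_ge_zero[of "x 0"] by linarith
  from local_extension[OF f this, of T']
  obtain \<delta> where "0 < \<delta>" and \<delta>: "\<forall>T \<phi> x. 0 \<le> T \<and> T \<le> T' \<and> solution_upto f \<phi> T x \<and>
      (\<forall>t\<in>{- 1..T}. norm (x t) \<le> J) \<longrightarrow> (\<exists>y. solution_upto f \<phi> (T + \<delta>) y)"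
    by (elim exE conjE)
  \<comment> \<open>A start less than one step before the end \<open>B\<close>, but not before time
    0.\<close>
  define T where "T = max 0 (B - \<delta> / 2)"
  have T: "0 \<le> T" "T < B" "B < T + \<delta>"
    using B \<open>0 < \<delta>\<close> by (auto simp: T_def)
  have sol: "solution_upto f \<phi> S x" if "0 \<le> S" "S < B" for S
    using dde_solution_imp_solution_upto[OF dde] that by (simp add: B)
  have "\<exists>y. solution_upto f \<phi> (T + \<delta>) y"
    by (rule \<delta>[rule_format, of T \<phi> x]) (use sol[OF T(1,2)] xJ T B in auto)
  then obtain y where y: "solution_upto f \<phi> (T + \<delta>) y" ..
  have "dde_solution f \<phi> (T + \<delta>) y"
    using T \<open>0 < \<delta>\<close> by (intro solution_upto_imp_dde_solution[OF f]) (auto intro: solution_upto_mono[OF y])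
  moreover have "y t = x t" if "- 1 \<le> t" "ereal t < b" for t
  proof -
    have "solution_upto f \<phi> (max 0 t) x" "solution_upto f \<phi> (max 0 t) y"
      using sol[of "max 0 t"] solution_upto_mono[OF y, of "max 0 t"] that B T by auto
    then show ?thesis
      by (rule solution_upto_unique[OF f]) (use that in auto)
  qed
  ultimately have "ereal (T + \<delta>) = b"
    using x[unfolded maximal_dde_solution_def, THEN conjunct2, rule_format, of "ereal (T + \<delta>)" y] T B
    by simp
  then show False
    using T B by simp
qed

lemma maximal_dde_solution_dde_max:
  assumes "f \<in> LC" "continuous_on {- 1..0} \<phi>"
  shows "maximal_dde_solution f \<phi> (fst (dde_max f \<phi>)) (dde_sol f \<phi>)"
proof -
  have "\<exists>p. case p of (b, x) \<Rightarrow> maximal_dde_solution f \<phi> b x"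
    using ex_maximal_dde_solution[OF assms] by auto
  from someI_ex[OF this] show ?thesis
    by (simp add: dde_max_def dde_sol_def split_def)
qed

section \<open>Continuous dependence\<close>

text \<open>One time step of the comparison. The hypothesis \<open>err\<close> speaks only of
  solutions in the ball of radius \<open>J\<close>; since \<open>J\<close> exceeds the norm of
  \<open>x\<close> by 1, distance at most 1 from \<open>x\<close> suffices to use it. The resulting
  bound \<open>6 * e\<close> is below 1, so distance 1 is never reached, and staying bounded rules
  out an end of \<open>w\<close> before \<open>t\<close>.\<close>

lemma maximal_solution_near:
  assumes g: "g \<in> LC" and f: "f \<in> LC"
    and w: "maximal_dde_solution g \<psi> b w"
    and x: "solution_upto f \<phi> t x" and xJ: "\<And>r. r \<in> {- 1..t} \<Longrightarrow> norm (x r) + 1 \<le> J"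
    and K: "caratheodory_bounds f (cball 0 (2 * J)) m l"
    and st: "0 \<le> s" "s \<le> t" and l: "integral {s..t} l \<le> 1 / 4"
    and sb: "ereal s < b" and e: "0 < e" "6 * e < 1"
    and before: "\<And>r. r \<in> {- 1..s} \<Longrightarrow> norm (w r - x r) \<le> e"
    and err: "\<And>\<tau> y. 0 \<le> \<tau> \<Longrightarrow> \<tau> \<le> t \<Longrightarrow> solution_upto g \<psi> \<tau> y \<Longrightarrow> (\<And>r. r \<in> {- 1..\<tau>} \<Longrightarrow> norm (y r) \<le> J) \<Longrightarrow>
      norm (integral {0..\<tau>} (\<lambda>s. g s (history y s) - f s (history y s))) \<le> e"
  shows "ereal t < b" "\<And>r. r \<in> {- 1..t} \<Longrightarrow> norm (w r - x r) \<le> 6 * e"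
proof -
  have dde: "dde_solution g \<psi> b w"
    using w by (simp add: maximal_dde_solution_def)
  have sol: "solution_upto g \<psi> \<tau> w" if "0 \<le> \<tau>" "ereal \<tau> < b" for \<tau>
    using dde_solution_imp_solution_upto[OF dde that] .
  have wJ: "norm (w r) \<le> J" if "r \<in> {- 1..t}" "norm (w r - x r) \<le> 1" for r
    using xJ[OF that(1)] that(2) norm_triangle_sub[of "w r" "x r"] by linarith
  \<comment> \<open>The improvement step: distance at most 1 up to \<open>\<tau>\<close> already
    implies distance at most \<open>6 * e\<close> there.\<close>
  have close: "norm (w r - x r) \<le> 6 * e"
    if \<tau>: "s \<le> \<tau>" "\<tau> \<le> t" "ereal \<tau> < b" and le1: "\<And>r. r \<in> {- 1..\<tau>} \<Longrightarrow> norm (w r - x r) \<le> 1"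
      and r: "r \<in> {- 1..\<tau>}" for \<tau> r
  proof -
    have w\<tau>: "solution_upto g \<psi> \<tau> w" and x\<tau>: "solution_upto f \<phi> \<tau> x"
      using sol[of \<tau>] solution_upto_mono[OF x] \<tau> st by auto
    have cont: "continuous_on {- 1..\<tau>} x" "continuous_on {- 1..\<tau>} w"
      using w\<tau> x\<tau> by (simp_all add: solution_upto_def)
    have wJ': "norm (w r) \<le> J" if "r \<in> {- 1..\<tau>}" for r
      using wJ[of r] le1[OF that] that \<tau> by auto
    have int: "(\<lambda>u. f u (history x u)) integrable_on {c..r}" "(\<lambda>u. f u (history w u)) integrable_on {c..r}"
      "(\<lambda>u. g u (history w u)) integrable_on {c..r}" if "0 \<le> c" "r \<le> \<tau>" for c r
      using integrable_along_history(2)[OF f cont(1) that] integrable_along_history(2)[OF f cont(2) that]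
        integrable_along_history(2)[OF g cont(2) that] by auto
    \<comment> \<open>One \<open>e\<close> is the distance at time \<open>s\<close>. Two more bound
      the error over \<open>{s..r}\<close>, the difference of two integrals from 0;
      \<open>lipschitz_step\<close> doubles the sum.\<close>
    have "norm (w r - x r) \<le> 2 * (3 * e)"
    proof (rule lipschitz_step[OF K _ cont st(1) \<tau>(1) _ _ _ _ r])
      show "(\<lambda>u. f u (history w u) - f u (history x u)) integrable_on {s..\<tau>}"
        using int st by (auto intro!: integrable_diff)
      show "history x r \<in> cball 0 (2 * J) \<and> history w r \<in> cball 0 (2 * J)" if "r \<in> {s..\<tau>}" for r
        using norm_history_le[of x r J] norm_history_le[of w r J] wJ'[of r] wJ'[of "r - 1"]
          xJ[of r] xJ[of "r - 1"] that st \<tau> by auto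
      have "integral {s..\<tau>} l \<le> integral {s..t} l"
        by (rule integral_subset_le) (use \<tau> caratheodory_boundsD[OF K] in auto)
      then show "integral {s..\<tau>} l \<le> 1 / 4"
        using l by simp
      show "norm (w r - x r) \<le> 3 * e" if "r \<in> {- 1..s}" for r
        using before[OF that] e by simp
      show "norm (w r - x r) \<le> 3 * e + norm (integral {s..r} (\<lambda>u. f u (history w u) - f u (history x u)))"
        if r: "r \<in> {s..\<tau>}" for r
      proof -
        let ?d = "\<lambda>u. g u (history w u) - f u (history w u)"
        have dint: "?d integrable_on {c..r}" if "0 \<le> c" for c
          using int[of c r] that r by (auto intro!: integrable_diff)
        have d: "norm (integral {0..v} ?d) \<le> e" if "v \<in> {s..\<tau>}" for v
        proof (rule err)
          show "solution_upto g \<psi> v w"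
            using solution_upto_mono[OF w\<tau>] that by simp
        qed (use that st \<tau> wJ' in auto)
        have "integral {0..s} ?d + integral {s..r} ?d = integral {0..r} ?d"
          using dint[of 0] r st by (intro Henstock_Kurzweil_Integration.integral_combine) auto
        then have "integral {s..r} ?d = integral {0..r} ?d - integral {0..s} ?d"
          by (simp add: algebra_simps)
        then have d2: "norm (integral {s..r} ?d) \<le> e + e"
          using d[of r] d[of s] r \<tau> norm_triangle_ineq4[of "integral {0..r} ?d" "integral {0..s} ?d"] by simp
        have "w r - x r = (w s - x s) + (w r - w s) - (x r - x s)"
          by simp
        also have "\<dots> = (w s - x s) + integral {s..r} ?d + integral {s..r} (\<lambda>u. f u (history w u) - f u (history x u))"
          using solution_upto_increment[OF g w\<tau> st(1), of r] solution_upto_increment[OF f x\<tau> st(1), of r] r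
            int[OF st(1), of r] by (simp add: integral_diff)
        finally have eq: "w r - x r = (w s - x s) + integral {s..r} ?d +
            integral {s..r} (\<lambda>u. f u (history w u) - f u (history x u))" .
        have "norm (w r - x r) \<le> norm (w s - x s) + norm (integral {s..r} ?d) +
            norm (integral {s..r} (\<lambda>u. f u (history w u) - f u (history x u)))"
          unfolding eq by (rule order_trans[OF norm_triangle_ineq add_right_mono[OF norm_triangle_ineq]])
        then show ?thesis
          using d2 before[of s] st by simp
      qed
    qed
    then show ?thesis by simp
  qed
  have bounded: "norm (w r - x r) \<le> 1" if \<tau>: "s \<le> \<tau>" "\<tau> \<le> t" "ereal \<tau> < b" and r: "r \<in> {- 1..\<tau>}" for \<tau> r
  proof (rule ccontr)
    assume contr: "\<not> norm (w r - x r) \<le> 1"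
    have cont: "continuous_on {s..\<tau>} (\<lambda>r. norm (w r - x r))"
      using sol[of \<tau>] x \<tau> st unfolding solution_upto_def
      by (intro continuous_intros) (auto elim!: continuous_on_subset)
    define Z where "Z = {r \<in> {s..\<tau>}. 1 \<le> norm (w r - x r)}"
    have "closed Z"
      unfolding Z_def using cont by (intro continuous_on_closed_Collect_le) auto
    moreover have "bounded Z"
      by (rule bounded_subset[of "{s..\<tau>}"]) (auto simp: Z_def)
    ultimately have "compact Z"
      by (simp add: compact_eq_bounded_closed)
    moreover have "r \<in> Z"
    proof -
      have "s < r"
        using contr before[of r] r e by (cases "r \<le> s") auto
      then show ?thesis
        using contr r by (simp add: Z_def)
    qed
    ultimately obtain r1 where r1: "r1 \<in> Z" "\<And>r. r \<in> Z \<Longrightarrow> r1 \<le> r"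
      using compact_attains_inf[of Z] by blast
    obtain r2 where r2: "s \<le> r2" "r2 \<le> r1" "norm (w r2 - x r2) = 1"
      \<comment> \<open>The first time \<open>r1\<close> at distance at least 1 has distance exactly
        1: an intermediate value 1 occurs no later than \<open>r1\<close>, and by minimality not
        earlier. There \<open>close\<close> gives a value below 1.\<close>
      using IVT'[of "\<lambda>r. norm (w r - x r)" s 1 r1] r1(1) before[of s] st e
        continuous_on_subset[OF cont, of "{s..r1}"] by (auto simp: Z_def)
    then have "r2 \<in> Z"
      using r1(1) by (simp add: Z_def)
    with r2 r1(2) have r1_eq: "norm (w r1 - x r1) = 1"
      by force
    have r1b: "s \<le> r1" "r1 \<le> t" "ereal r1 < b"
      using r1(1) \<tau> by (auto simp: Z_def intro: le_less_trans[of _ "ereal \<tau>"])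
    have "norm (w r - x r) \<le> 1" if rr: "r \<in> {- 1..r1}" for r
    proof -
      consider "r \<le> s" | "s < r" "r < r1" | "r = r1"
        using rr less_linear[of r r1] by (cases "r \<le> s") auto
      then show ?thesis
      proof cases
        case 1
        then show ?thesis
          using before[of r] rr e by simp
      next
        case 2
        then have "r \<notin> Z"
          using r1(2)[of r] by auto
        then show ?thesis
          using 2 r1(1) by (auto simp: Z_def)
      qed (use r1_eq in simp)
    qed
    from close[OF r1b this, of r1] show False
      using r1_eq r1b st e by simp
  qed
  show tb: "ereal t < b"
  proof (rule ccontr)
    assume "\<not> ereal t < b"
    then have "b \<le> ereal t"
      by simp
    \<comment> \<open>A solution ending by time \<open>t\<close> would leave the ball of radius
      \<open>J\<close>, although distance at most 1 from \<open>x\<close> confines it there.\<close>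
    from maximal_dde_solution_unbounded[OF g w this, of J] obtain r where
      r: "- 1 \<le> r" "ereal r < b" "J < norm (w r)" by blast
    have "ereal r < ereal t"
      using r(2) \<open>b \<le> ereal t\<close> by (rule less_le_trans)
    then have "norm (w r - x r) \<le> 1"
      using bounded[of "max s r" r] r sb st by (auto simp: max_def)
    then show False
      using wJ[of r] r \<open>ereal r < ereal t\<close> by simp
  qed
  show "norm (w r - x r) \<le> 6 * e" if "r \<in> {- 1..t}" for r
    using close[OF st(2) order_refl tb bounded[OF st(2) order_refl tb] that] .
qed

text \<open>The integral error is only required to be small along solutions of the approximating
  equations that stay in a fixed ball.\<close>

definition vanishing_error ::
  "(nat \<Rightarrow> ('n::finite) rhs) \<Rightarrow> (nat \<Rightarrow> real \<Rightarrow> real^'n) \<Rightarrow> 'n rhs \<Rightarrow> real \<Rightarrow> real \<Rightarrow> bool" where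
  "vanishing_error fs \<phi>s f J T \<longleftrightarrow> (\<forall>e>0. \<forall>\<^sub>F n in sequentially. \<forall>\<tau> y. 0 \<le> \<tau> \<and> \<tau> \<le> T \<and>
      solution_upto (fs n) (\<phi>s n) \<tau> y \<and> (\<forall>r\<in>{- 1..\<tau>}. norm (y r) \<le> J) \<longrightarrow>
      norm (integral {0..\<tau>} (\<lambda>s. fs n s (history y s) - f s (history y s))) \<le> e)"

text \<open>Convergence up to time \<open>s\<close> is propagated over finitely many short steps.
  Each step loses a factor 6, which is harmless because the propagated statement quantifies over all
  tolerances.\<close>

lemma solutions_converge_if_vanishing_error:
  fixes f :: "('n::finite) rhs"
  assumes f: "f \<in> LC" and fs: "\<And>n. fs n \<in> LC"
    and \<phi>: "continuous_on {- 1..0} \<phi>" and \<phi>s: "\<And>n. continuous_on {- 1..0} (\<phi>s n)"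
    and lim: "uniform_limit {- 1..0} \<phi>s \<phi> sequentially"
    and err: "\<And>J T. 0 \<le> T \<Longrightarrow> vanishing_error fs \<phi>s f J T"
  shows "solutions_converge fs \<phi>s f \<phi>"
  unfolding solutions_converge_def
proof (intro allI impI)
  fix T0 assume T0: "{- 1..T0} \<subseteq> dde_interval f \<phi>"
  \<comment> \<open>\<open>T0\<close> may be negative; since time 0 always lies in the domain of
    \<open>x\<close>, the larger interval is still contained in it.\<close>
  define T where "T = max 0 T0"
  define x where "x = dde_sol f \<phi>"
  define b where "b = fst (dde_max f \<phi>)"
  define w where "w n = dde_sol (fs n) (\<phi>s n)" for n
  define c where "c n = fst (dde_max (fs n) (\<phi>s n))" for n
  have x: "maximal_dde_solution f \<phi> b x"
    unfolding x_def b_def using f \<phi> by (rule maximal_dde_solution_dde_max)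
  have w: "maximal_dde_solution (fs n) (\<phi>s n) (c n) (w n)" for n
    unfolding w_def c_def using fs \<phi>s by (rule maximal_dde_solution_dde_max)
  have T: "0 \<le> T" "T0 \<le> T"
    by (auto simp: T_def)
  have "0 < b"
    using x by (simp add: maximal_dde_solution_def dde_solution_def)
  have Tb: "ereal T < b"
  proof (cases "0 \<le> T0")
    case True
    then have "T0 \<in> dde_interval f \<phi>"
      using T0 by auto
    then show ?thesis
      using True by (simp add: dde_interval_def b_def T_def max_absorb2)
  next
    case False
    then show ?thesis
      using \<open>0 < b\<close> by (simp add: T_def max_absorb1 zero_ereal_def)
  qed
  have sol: "solution_upto f \<phi> T x"
    using dde_solution_imp_solution_upto[OF _ T(1) Tb] x[unfolded maximal_dde_solution_def] by blast
  then have "bounded (x ` {- 1..T})"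
    by (intro compact_imp_bounded compact_continuous_image) (auto simp: solution_upto_def)
  then obtain J0 where J0: "\<forall>r\<in>{- 1..T}. norm (x r) \<le> J0"
    unfolding bounded_iff by auto
  define J where "J = J0 + 1"
  have xJ: "norm (x r) + 1 \<le> J" if "r \<in> {- 1..T}" for r
    using J0 that by (simp add: J_def)
  obtain m l where K: "caratheodory_bounds f (cball 0 (2 * J)) m l"
    by (rule LC_boundsE[OF f compact_cball])
  obtain d where d: "0 < d" "\<And>s t. 0 \<le> s \<Longrightarrow> t \<le> T \<Longrightarrow> t - s < d \<Longrightarrow> integral {s..t} l < 1 / 4"
    by (rule integral_small_on_short_intervals[where h = l and a = 0 and b = T and e = "1 / 4"])
      (use caratheodory_boundsD[OF K] in auto)
  define P where "P s \<longleftrightarrow> (\<forall>e>0. \<forall>\<^sub>F n in sequentially.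
      ereal s < c n \<and> (\<forall>r\<in>{- 1..s}. norm (w n r - x r) \<le> e))" for s
  have "P T"
  proof (rule small_step_induct[OF d(1) T(1)])
    show "P 0"
      unfolding P_def
    proof (intro allI impI)
      fix e :: real assume "0 < e"
      with lim have "\<forall>\<^sub>F n in sequentially. \<forall>r\<in>{- 1..0}. dist (\<phi>s n r) (\<phi> r) < e"
        by (simp add: uniform_limit_iff)
      then show "\<forall>\<^sub>F n in sequentially. ereal 0 < c n \<and> (\<forall>r\<in>{- 1..0}. norm (w n r - x r) \<le> e)"
      proof eventually_elim
        case (elim n)
        have "w n r - x r = \<phi>s n r - \<phi> r" if "r \<in> {- 1..0}" for r
          using x w[of n] that by (simp add: maximal_dde_solution_def dde_solution_def)
        moreover have "0 < c n"
          using w[of n] by (simp add: maximal_dde_solution_def dde_solution_def)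
        ultimately show ?case
          using elim by (auto simp: dist_norm zero_ereal_def intro: less_imp_le)
      qed
    qed
    fix s t assume st: "0 \<le> s" "s \<le> t" "t \<le> T" "t - s < d" and Ps: "P s"
    show "P t"
      unfolding P_def
    proof (intro allI impI)
      fix e0 :: real assume "0 < e0"
      \<comment> \<open>The first entry pays for the factor 6, the second makes \<open>6 * e\<close>
        less than 1 as \<open>maximal_solution_near\<close> requires.\<close>
      define e where "e = min (e0 / 6) (1 / 12)"
      have e: "0 < e" "6 * e < 1" "6 * e \<le> e0"
        using \<open>0 < e0\<close> by (auto simp: e_def)
      have "\<forall>\<^sub>F n in sequentially. ereal s < c n \<and> (\<forall>r\<in>{- 1..s}. norm (w n r - x r) \<le> e)"
        using Ps e(1) by (simp add: P_def)
      moreover have "\<forall>\<^sub>F n in sequentially. \<forall>\<tau> y. 0 \<le> \<tau> \<and> \<tau> \<le> T \<and>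
          solution_upto (fs n) (\<phi>s n) \<tau> y \<and> (\<forall>r\<in>{- 1..\<tau>}. norm (y r) \<le> J) \<longrightarrow>
          norm (integral {0..\<tau>} (\<lambda>s. fs n s (history y s) - f s (history y s))) \<le> e"
        using err[OF T(1)] e(1) by (simp add: vanishing_error_def)
      ultimately show "\<forall>\<^sub>F n in sequentially. ereal t < c n \<and> (\<forall>r\<in>{- 1..t}. norm (w n r - x r) \<le> e0)"
      proof eventually_elim
        case (elim n)
        have err_n: "norm (integral {0..\<tau>} (\<lambda>s. fs n s (history y s) - f s (history y s))) \<le> e"
          if "0 \<le> \<tau>" "\<tau> \<le> t" "solution_upto (fs n) (\<phi>s n) \<tau> y" "\<And>r. r \<in> {- 1..\<tau>} \<Longrightarrow> norm (y r) \<le> J" for \<tau> y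
          using elim(2) that st by auto
        have xt: "norm (x r) + 1 \<le> J" if "r \<in> {- 1..t}" for r
          using xJ that st by simp
        have lt: "integral {s..t} l \<le> 1 / 4"
          using d(2)[of s t] st by simp
        have bs: "norm (w n r - x r) \<le> e" if "r \<in> {- 1..s}" for r
          using elim(1) that by blast
        have "ereal t < c n"
          by (rule maximal_solution_near(1)[OF fs[of n] f w[of n] solution_upto_mono[OF sol st(3)] xt K st(1,2) lt
              conjunct1[OF elim(1)] e(1,2) bs err_n])
        moreover have "norm (w n r - x r) \<le> 6 * e" if "r \<in> {- 1..t}" for r
          by (rule maximal_solution_near(2)[OF fs[of n] f w[of n] solution_upto_mono[OF sol st(3)] xt K st(1,2) lt
              conjunct1[OF elim(1)] e(1,2) bs err_n that])
        then have "\<forall>r\<in>{- 1..t}. norm (w n r - x r) \<le> e0"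
          using e(3) order_trans by blast
        ultimately show ?case by blast
      qed
    qed
  qed
  then have ev: "\<forall>\<^sub>F n in sequentially. ereal T < c n \<and> (\<forall>r\<in>{- 1..T}. norm (w n r - x r) \<le> e)" if "0 < e" for e
    using that by (simp add: P_def)
  have "\<forall>\<^sub>F n in sequentially. {- 1..T0} \<subseteq> dde_interval (fs n) (\<phi>s n)"
    using ev[of 1, OF zero_less_one]
  proof eventually_elim
    case (elim n)
    have "ereal r < c n" if "r \<le> T0" for r
      using that T(2) elim by (auto intro: le_less_trans[of _ "ereal T"])
    then show ?case
      by (auto simp: dde_interval_def c_def)
  qed
  moreover have "uniform_limit {- 1..T0} (\<lambda>n. dde_sol (fs n) (\<phi>s n)) (dde_sol f \<phi>) sequentially"
    unfolding uniform_limit_iff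
  proof (intro allI impI)
    fix e :: real assume "0 < e"
    then have "0 < e / 2" by simp
    from ev[OF this] show "\<forall>\<^sub>F n in sequentially. \<forall>r\<in>{- 1..T0}. dist (dde_sol (fs n) (\<phi>s n) r) (dde_sol f \<phi> r) < e"
    proof eventually_elim
      case (elim n)
      have "norm (w n r - x r) < e" if "r \<in> {- 1..T0}" for r
      proof -
        have "norm (w n r - x r) \<le> e / 2"
          using elim that T(2) by auto
        then show ?thesis
          using \<open>0 < e\<close> by linarith
      qed
      then show ?case
        by (simp add: w_def x_def dist_norm)
    qed
  qed
  ultimately show "(\<forall>\<^sub>F n in sequentially. {- 1..T0} \<subseteq> dde_interval (fs n) (\<phi>s n)) \<and>
      uniform_limit {- 1..T0} (\<lambda>n. dde_sol (fs n) (\<phi>s n)) (dde_sol f \<phi>) sequentially"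
    by blast
qed

section \<open>Reduction of the error to short rational intervals\<close>

text \<open>Only monotonicity of the nonnegative integral is used, so the extended-valued suprema
  \<open>m_bound\<close> and \<open>l_bound\<close> can serve as majorants.\<close>

lemma norm_integral_le_nn_integral:
  fixes F :: "real \<Rightarrow> 'b::euclidean_space"
  assumes F: "F absolutely_integrable_on S" and le: "\<And>u. u \<in> S \<Longrightarrow> ennreal (norm (F u)) \<le> G u"
  shows "ennreal (norm (integral S F)) \<le> (\<integral>\<^sup>+u\<in>S. G u \<partial>lebesgue)"
proof -
  have "ennreal (norm (integral S F)) = ennreal (norm (LINT u:S|lebesgue. F u))"
    using set_lebesgue_integral_eq_integral(2)[OF F] by simp
  also have "\<dots> \<le> (\<integral>\<^sup>+u. ennreal (norm (indicator S u *\<^sub>R F u)) \<partial>lebesgue)"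
    unfolding set_lebesgue_integral_def using F
    by (intro integral_norm_bound_ennreal) (simp add: set_integrable_def)
  also have "\<dots> \<le> (\<integral>\<^sup>+u\<in>S. G u \<partial>lebesgue)"
    by (rule nn_integral_mono) (use le in \<open>auto simp: indicator_def\<close>)
  finally show ?thesis .
qed

lemma norm_integral_history_le:
  assumes f: "f \<in> LC" and y: "continuous_on {- 1..\<tau>} y" "\<And>r. r \<in> {- 1..\<tau>} \<Longrightarrow> norm (y r) \<le> real J"
    and st: "0 \<le> s" "t \<le> \<tau>"
  shows "ennreal (norm (integral {s..t} (\<lambda>u. f u (history y u)))) \<le>
    (\<integral>\<^sup>+u\<in>{s..t}. m_bound f (2 * J) u \<partial>lebesgue)"
proof (rule norm_integral_le_nn_integral[OF integrable_along_history(1)[OF f y(1) st]])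
  fix u assume u: "u \<in> {s..t}"
  then have "norm (history y u) \<le> 2 * real J"
    using st by (intro norm_history_le y(2)) auto
  then show "ennreal (norm (f u (history y u))) \<le> m_bound f (2 * J) u"
    unfolding m_bound_def by (intro SUP_upper) simp
qed

lemma equicontinuous_m_boundsE:
  assumes "equicontinuous_m_bounds E" "0 < r" "0 < e"
  obtains d where "0 < d" "\<And>f s t. f \<in> E \<Longrightarrow> - r \<le> s \<Longrightarrow> s \<le> t \<Longrightarrow> t \<le> r \<Longrightarrow> t - s < d \<Longrightarrow>
    (\<integral>\<^sup>+u\<in>{s..t}. m_bound f j u \<partial>lebesgue) \<le> ennreal e"
proof -
  from assms(1)[unfolded equicontinuous_m_bounds_def, rule_format, OF assms(2,3), of j]
  obtain d where d: "0 < d" "\<And>s t. - r \<le> s \<and> s \<le> t \<and> t \<le> r \<and> t - s < d \<longrightarrow>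
        (SUP f\<in>E. \<integral>\<^sup>+u\<in>{s..t}. m_bound f j u \<partial>lebesgue) < ennreal e"
    by auto
  show thesis
  proof (rule that[OF d(1)])
    fix f s t assume "f \<in> E" and st: "- r \<le> s" "s \<le> t" "t \<le> r" "t - s < d"
    have "(\<integral>\<^sup>+u\<in>{s..t}. m_bound f j u \<partial>lebesgue) \<le> (SUP f\<in>E. \<integral>\<^sup>+u\<in>{s..t}. m_bound f j u \<partial>lebesgue)"
      using \<open>f \<in> E\<close> by (rule SUP_upper)
    also have "\<dots> < ennreal e"
      using d(2) st by blast
    finally show "(\<integral>\<^sup>+u\<in>{s..t}. m_bound f j u \<partial>lebesgue) \<le> ennreal e"
      by simp
  qed
qed

lemma integral_eq_sum_mesh:
  fixes h :: "real \<Rightarrow> 'b::banach"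
  assumes "0 \<le> d" "h integrable_on {a..a + real k * d}"
  shows "integral {a..a + real k * d} h = (\<Sum>i<k. integral {a + real i * d..a + real (Suc i) * d} h)"
  using assms(2)
proof (induction k)
  case (Suc k)
  have le: "a \<le> a + real k * d" "a + real k * d \<le> a + real (Suc k) * d"
    using assms(1) by (auto intro!: mult_right_mono)
  have "h integrable_on {a..a + real k * d}"
    using Suc.prems le by (auto intro: integrable_on_subinterval)
  with Suc.IH have "integral {a..a + real k * d} h = (\<Sum>i<k. integral {a + real i * d..a + real (Suc i) * d} h)"
    by blast
  then show ?case
    using Henstock_Kurzweil_Integration.integral_combine[OF le Suc.prems] by simp
qed simp

text \<open>The intervals are kept on one side of \<open>1\<close>, so that the delayed argument \<open>t - 1\<close> does not cross
  \<open>0\<close>, where the modulus of continuity of a solution changes.\<close>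

definition vanishing_local_error ::
  "(nat \<Rightarrow> ('n::finite) rhs) \<Rightarrow> (nat \<Rightarrow> real \<Rightarrow> real^'n) \<Rightarrow> 'n rhs \<Rightarrow> nat \<Rightarrow> real \<Rightarrow> bool" where
  "vanishing_local_error fs \<phi>s f J T \<longleftrightarrow> (\<exists>d>0. \<forall>a b e. a \<in> \<rat> \<and> b \<in> \<rat> \<and> 0 \<le> a \<and> a \<le> b \<and> b \<le> T \<and> b - a < d \<and>
     (b \<le> 1 \<or> 1 \<le> a) \<and> 0 < e \<longrightarrow>
     (\<forall>\<^sub>F n in sequentially. \<forall>\<tau> y. b \<le> \<tau> \<and> \<tau> \<le> T \<and>
      solution_upto (fs n) (\<phi>s n) \<tau> y \<and> (\<forall>r\<in>{- 1..\<tau>}. norm (y r) \<le> real J) \<longrightarrow>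
      norm (integral {a..b} (\<lambda>s. fs n s (history y s) - f s (history y s))) \<le> e))"

text \<open>A mesh with finitely many rational cells carries the local estimates. The cell
  containing the end \<open>\<tau>\<close> is incomplete and has no rational endpoint in general, so
  there both right-hand sides are bounded separately over a short time. Each of the three
  contributions is at most \<open>e / 3\<close>.\<close>

lemma vanishing_error_if_local:
  fixes f :: "('n::finite) rhs"
  assumes E: "E \<subseteq> LC" "equicontinuous_m_bounds E" and fs: "\<And>n. fs n \<in> E" and f: "f \<in> LC"
    and local: "\<And>J. vanishing_local_error fs \<phi>s f J T" and T: "0 \<le> T"
  shows "vanishing_error fs \<phi>s f J0 T"
  unfolding vanishing_error_def
proof (intro allI impI)
  fix e :: real assume "0 < e"
  then have e3: "0 < e / 3" by simp
  obtain J :: nat where J: "J0 \<le> real J"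
    using real_arch_simple by blast
  obtain d0 where "0 < d0" and d0: "\<forall>a b e. a \<in> \<rat> \<and> b \<in> \<rat> \<and> 0 \<le> a \<and> a \<le> b \<and> b \<le> T \<and> b - a < d0 \<and>
     (b \<le> 1 \<or> 1 \<le> a) \<and> 0 < e \<longrightarrow>
     (\<forall>\<^sub>F n in sequentially. \<forall>\<tau> y. b \<le> \<tau> \<and> \<tau> \<le> T \<and>
      solution_upto (fs n) (\<phi>s n) \<tau> y \<and> (\<forall>r\<in>{- 1..\<tau>}. norm (y r) \<le> real J) \<longrightarrow>
      norm (integral {a..b} (\<lambda>s. fs n s (history y s) - f s (history y s))) \<le> e)"
    using local[of J] unfolding vanishing_local_error_def by (elim exE conjE)
  have "0 < T + 1"
    using T by simp
  from equicontinuous_m_boundsE[OF E(2) this e3, where j = "2 * J"]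
  obtain d1 where d1: "0 < d1" "\<And>f s t. f \<in> E \<Longrightarrow> - (T + 1) \<le> s \<Longrightarrow> s \<le> t \<Longrightarrow> t \<le> T + 1 \<Longrightarrow> t - s < d1 \<Longrightarrow>
      (\<integral>\<^sup>+u\<in>{s..t}. m_bound f (2 * J) u \<partial>lebesgue) \<le> ennreal (e / 3)"
    by blast
  \<comment> \<open>The equicontinuous bounds cover only members of \<open>E\<close>; the limit is
    estimated by its own bound.\<close>
  obtain m l where K: "caratheodory_bounds f (cball 0 (2 * real J)) m l"
    by (rule LC_boundsE[OF f compact_cball])
  obtain d2 where d2: "0 < d2" "\<And>s t. 0 \<le> s \<Longrightarrow> t \<le> T \<Longrightarrow> t - s < d2 \<Longrightarrow> integral {s..t} m < e / 3"
    by (rule integral_small_on_short_intervals[where h = m and a = 0 and b = T and e = "e / 3"])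
      (use caratheodory_boundsD[OF K] e3 in auto)
  define d where "d = min d0 (min d1 d2)"
  have "0 < d"
    using \<open>0 < d0\<close> d1(1) d2(1) by (simp add: d_def)
  then obtain N where N: "inverse (real (Suc N)) < d"
    using reals_Archimedean by blast
  \<comment> \<open>The reciprocal of an integer is rational and makes 1 a mesh point, so no cell
    crosses 1.\<close>
  define h where "h = inverse (real (Suc N))"
  have h: "0 < h" "h < d0" "h < d1" "h < d2" "h * real (Suc N) = 1"
    using N by (auto simp: h_def d_def)
  \<comment> \<open>A bound for the number of cells that serves every \<open>\<tau>\<close> up to
    \<open>T\<close>, so each cell may contribute \<open>e / (3 * real n0)\<close>.\<close>
  define n0 where "n0 = nat \<lceil>T / h\<rceil> + 1"
  define pts where "pts = {i \<in> {..<n0}. real (Suc i) * h \<le> T}"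
  have "\<forall>\<^sub>F n in sequentially. \<forall>i\<in>pts. \<forall>\<tau> y. real (Suc i) * h \<le> \<tau> \<and> \<tau> \<le> T \<and>
      solution_upto (fs n) (\<phi>s n) \<tau> y \<and> (\<forall>r\<in>{- 1..\<tau>}. norm (y r) \<le> real J) \<longrightarrow>
      norm (integral {real i * h..real (Suc i) * h} (\<lambda>s. fs n s (history y s) - f s (history y s))) \<le> e / (3 * real n0)"
  proof (rule eventually_ball_finite)
    show "finite pts"
      by (simp add: pts_def)
    show "\<forall>i\<in>pts. \<forall>\<^sub>F n in sequentially. \<forall>\<tau> y. real (Suc i) * h \<le> \<tau> \<and> \<tau> \<le> T \<and>
      solution_upto (fs n) (\<phi>s n) \<tau> y \<and> (\<forall>r\<in>{- 1..\<tau>}. norm (y r) \<le> real J) \<longrightarrow>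
      norm (integral {real i * h..real (Suc i) * h} (\<lambda>s. fs n s (history y s) - f s (history y s))) \<le> e / (3 * real n0)"
    proof (intro ballI d0[rule_format] conjI)
      fix i assume i: "i \<in> pts"
      show "real i * h \<in> \<rat>" "real (Suc i) * h \<in> \<rat>"
        unfolding h_def by (intro Rats_mult Rats_inverse Rats_of_nat)+
      show "real i * h \<le> real (Suc i) * h"
        using h by (intro mult_right_mono) auto
      show "real (Suc i) * h - real i * h < d0"
        using h by (simp add: distrib_right)
      show "real (Suc i) * h \<le> T"
        using i by (simp add: pts_def)
      show "real (Suc i) * h \<le> 1 \<or> 1 \<le> real i * h"
      proof (cases "i \<le> N")
        case True
        then have "real (Suc i) * h \<le> real (Suc N) * h"
          using h by (intro mult_right_mono) auto
        then show ?thesis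
          using h(5) by (simp add: mult.commute)
      next
        case False
        then have "real (Suc N) * h \<le> real i * h"
          using h by (intro mult_right_mono) auto
        then show ?thesis
          using h(5) by (simp add: mult.commute)
      qed
    qed (use h \<open>0 < e\<close> in \<open>auto simp: n0_def\<close>)
  qed
  then show "\<forall>\<^sub>F n in sequentially. \<forall>\<tau> y. 0 \<le> \<tau> \<and> \<tau> \<le> T \<and>
      solution_upto (fs n) (\<phi>s n) \<tau> y \<and> (\<forall>r\<in>{- 1..\<tau>}. norm (y r) \<le> J0) \<longrightarrow>
      norm (integral {0..\<tau>} (\<lambda>s. fs n s (history y s) - f s (history y s))) \<le> e"
  proof eventually_elim
    case (elim n)
    show ?case
    proof (intro allI impI)
      fix \<tau> y assume "0 \<le> \<tau> \<and> \<tau> \<le> T \<and> solution_upto (fs n) (\<phi>s n) \<tau> y \<and> (\<forall>r\<in>{- 1..\<tau>}. norm (y r) \<le> J0)"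
      then have \<tau>: "0 \<le> \<tau>" "\<tau> \<le> T" and y: "solution_upto (fs n) (\<phi>s n) \<tau> y"
        and yJ: "\<And>r. r \<in> {- 1..\<tau>} \<Longrightarrow> norm (y r) \<le> real J"
        using J by force+
      have cont: "continuous_on {- 1..\<tau>} y"
        using y by (simp add: solution_upto_def)
      have fn: "fs n \<in> LC"
        using fs E by blast
      let ?g = "\<lambda>s. fs n s (history y s) - f s (history y s)"
      have int: "(\<lambda>s. fs n s (history y s)) integrable_on {a..b}" "(\<lambda>s. f s (history y s)) integrable_on {a..b}"
        "?g integrable_on {a..b}" if "0 \<le> a" "b \<le> \<tau>" for a b
        using integrable_along_history(2)[OF fn cont that] integrable_along_history(2)[OF f cont that]
        by (auto intro: integrable_diff)
      define k where "k = nat \<lfloor>\<tau> / h\<rfloor>"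
      have k: "real k * h \<le> \<tau>" "\<tau> < real k * h + h"
      proof -
        have "real k = of_int \<lfloor>\<tau> / h\<rfloor>"
          using \<tau> h by (simp add: k_def)
        then have "real k \<le> \<tau> / h" "\<tau> / h < real k + 1"
          by linarith+
        then show "real k * h \<le> \<tau>" "\<tau> < real k * h + h"
          using h by (simp_all add: field_simps)
      qed
      have kn: "k \<le> n0"
      proof -
        have "\<tau> / h \<le> T / h"
          using \<tau> h by (intro divide_right_mono) auto
        then have "\<lfloor>\<tau> / h\<rfloor> \<le> \<lceil>T / h\<rceil>"
          by linarith
        then show ?thesis
          by (simp add: k_def n0_def)
      qed
      have "integral {0..0 + real k * h} ?g = (\<Sum>i<k. integral {0 + real i * h..0 + real (Suc i) * h} ?g)"
        by (rule integral_eq_sum_mesh) (use h int(3)[of 0 "real k * h"] k in auto)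
      then have "norm (integral {0..real k * h} ?g) \<le> (\<Sum>i<k. norm (integral {real i * h..real (Suc i) * h} ?g))"
        by (simp add: norm_sum)
      also have "\<dots> \<le> (\<Sum>i<k. e / (3 * real n0))"
      proof (rule sum_mono)
        fix i assume i: "i \<in> {..<k}"
        then have "real (Suc i) * h \<le> real k * h"
          using h by (intro mult_right_mono) auto
        then have le: "real (Suc i) * h \<le> \<tau>"
          by (rule order_trans[OF _ k(1)])
        moreover have "i \<in> pts"
          using i kn le \<tau> by (auto simp: pts_def)
        ultimately show "norm (integral {real i * h..real (Suc i) * h} ?g) \<le> e / (3 * real n0)"
          using elim y yJ \<tau> by blast
      qed
      also have "\<dots> = real k * (e / (3 * real n0))"
        by simp
      also have "\<dots> \<le> real n0 * (e / (3 * real n0))"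
        using kn \<open>0 < e\<close> by (intro mult_right_mono) auto
      also have "\<dots> = e / 3"
      proof -
        have "n0 \<noteq> 0"
          by (simp add: n0_def)
        then show ?thesis
          by simp
      qed
      finally have A: "norm (integral {0..real k * h} ?g) \<le> e / 3" .
      have kh: "0 \<le> real k * h"
        using h by simp
      have "ennreal (norm (integral {real k * h..\<tau>} (\<lambda>s. fs n s (history y s)))) \<le>
          (\<integral>\<^sup>+u\<in>{real k * h..\<tau>}. m_bound (fs n) (2 * J) u \<partial>lebesgue)"
        by (rule norm_integral_history_le[OF fn cont yJ kh order_refl])
      also have "\<dots> \<le> ennreal (e / 3)"
        by (rule d1(2)[OF fs]; use k kh h \<tau> in linarith)
      finally have B: "norm (integral {real k * h..\<tau>} (\<lambda>s. fs n s (history y s))) \<le> e / 3"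
        using e3 by (simp add: ennreal_le_iff)
      have "norm (integral {real k * h..\<tau>} (\<lambda>s. f s (history y s))) \<le> integral {real k * h..\<tau>} m"
      proof (rule integral_norm_bound_AE[OF int(2)[OF kh order_refl] caratheodory_boundsD(5)[OF K]])
        have "history y s \<in> cball 0 (2 * real J)" if "s \<in> {real k * h..\<tau>}" for s
          using norm_history_le[of y s "real J"] yJ[of s] yJ[of "s - 1"] kh that by auto
        with caratheodory_boundsD(7)[OF K]
        show "AE s in lebesgue. s \<in> {real k * h..\<tau>} \<longrightarrow> norm (f s (history y s)) \<le> m s"
          by (auto elim: eventually_mono)
      qed
      also have "\<dots> < e / 3"
        by (rule d2(2); use k kh h \<tau> in linarith)
      finally have C: "norm (integral {real k * h..\<tau>} (\<lambda>s. f s (history y s))) < e / 3" .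
      have "integral {0..\<tau>} ?g = integral {0..real k * h} ?g + integral {real k * h..\<tau>} ?g"
        using Henstock_Kurzweil_Integration.integral_combine[OF kh k(1) int(3)[OF order_refl order_refl]] by simp
      also have "integral {real k * h..\<tau>} ?g = integral {real k * h..\<tau>} (\<lambda>s. fs n s (history y s)) -
          integral {real k * h..\<tau>} (\<lambda>s. f s (history y s))"
        using int[OF kh order_refl] by (simp add: integral_diff)
      also have "norm (integral {0..real k * h} ?g + \<dots>) \<le> e / 3 + (e / 3 + e / 3)"
        using A B C by (intro norm_triangle_mono order_trans[OF norm_triangle_ineq4] add_mono) auto
      finally show "norm (integral {0..\<tau>} ?g) \<le> e"
        by simp
    qed
  qed
qed

section \<open>The topologies\<close>

text \<open>The generating set centred at the limit itself is a neighbourhood of it, because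
  \<open>p\<close> vanishes at the zero function.\<close>

lemma limitin_LC_topologyD:
  assumes lim: "limitin (LC_topology P) fs f sequentially" and f: "f \<in> LC" and p: "p \<in> P"
    and zero: "p (\<lambda>t z. 0) = 0" and "0 < e"
  shows "\<forall>\<^sub>F n in sequentially. p (\<lambda>t z. fs n t z - f t z) < e"
proof -
  let ?U = "{g \<in> LC. p (\<lambda>t z. g t z - f t z) < e}"
  have "openin (LC_topology P) ?U"
    unfolding LC_topology_def by (rule topology_generated_by_Basis) (use f p \<open>0 < e\<close> in blast)
  moreover have "f \<in> ?U"
    using f zero \<open>0 < e\<close> by simp
  ultimately have "\<forall>\<^sub>F n in sequentially. fs n \<in> ?U"
    using lim unfolding limitin_def by blast
  then show ?thesis
    by eventually_elim simp
qed

text \<open>The supremum of an empty set of reals would be unspecified; nonnegative moduli put the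
  zero function into both classes.\<close>

lemma seminorm_Theta_zero:
  fixes \<Theta> \<Theta>' :: moduli
  assumes "\<And>s. 0 \<le> \<Theta> j a b s" "\<And>s. 0 \<le> \<Theta>' j (a - 1) (b - 1) s"
  shows "seminorm_Theta \<Theta> \<Theta>' j a b (\<lambda>t z. 0 :: real^'n::finite) = 0"
proof -
  have "(\<lambda>_. 0) \<in> (moduli_class \<Theta> j a b :: (real \<Rightarrow> real^'n) set)"
    "(\<lambda>_. 0) \<in> (moduli_class \<Theta>' j (a - 1) (b - 1) :: (real \<Rightarrow> real^'n) set)"
    using assms by (auto simp: moduli_class_def admits_modulus_def)
  then have "(moduli_class \<Theta> j a b :: (real \<Rightarrow> real^'n) set) \<times>
      (moduli_class \<Theta>' j (a - 1) (b - 1) :: (real \<Rightarrow> real^'n) set) \<noteq> {}"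
    by blast
  then show ?thesis
    by (simp add: seminorm_Theta_def set_lebesgue_integral_def split_def)
qed

text \<open>A real supremum dominates its members only if the set is bounded above; the bound of
  \<open>g\<close> on the ball of radius \<open>2 * j\<close> gives a common majorant for all
  admissible pairs.\<close>

lemma norm_integral_le_seminorm_Theta:
  fixes g :: "('n::finite) rhs"
  assumes g: "g \<in> LC" and x: "x \<in> moduli_class \<Theta> j a b" and u: "u \<in> moduli_class \<Theta>' j (a - 1) (b - 1)"
  shows "norm (integral {a..b} (\<lambda>t. g t (x t, u (t - 1)))) \<le> seminorm_Theta \<Theta> \<Theta>' j a b g"
proof -
  let ?A = "moduli_class \<Theta> j a b \<times> moduli_class \<Theta>' j (a - 1) (b - 1) :: ((real \<Rightarrow> real^'n) \<times> (real \<Rightarrow> real^'n)) set"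
  let ?I = "\<lambda>(x, u). norm (LINT t:{a..b}|lebesgue. g t (x t, u (t - 1)))"
  have int: "(\<lambda>t. g t (x t, u (t - 1))) absolutely_integrable_on {a..b}" if "(x, u) \<in> ?A" for x u
  proof (rule LC_integrable_continuous[OF g])
    have c: "continuous_on {a..b} x" "continuous_on {a - 1..b - 1} u"
      using that by (auto simp: moduli_class_def)
    show "continuous_on {a..b} (\<lambda>t. (x t, u (t - 1)))"
      by (intro continuous_on_Pair c(1) continuous_on_compose2[OF c(2)] continuous_intros) auto
  qed
  obtain m l where K: "caratheodory_bounds g (cball 0 (2 * real j)) m l"
    by (rule LC_boundsE[OF g compact_cball])
  have "bdd_above (?I ` ?A)"
  proof (rule bdd_aboveI2)
    fix p assume "p \<in> ?A"
    then obtain x u where p: "p = (x, u)" "(x, u) \<in> ?A"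
      by (cases p) auto
    have "norm (integral {a..b} (\<lambda>t. g t (x t, u (t - 1)))) \<le> integral {a..b} m"
    proof (rule integral_norm_bound_AE[OF set_lebesgue_integral_eq_integral(1)[OF int[OF p(2)]] caratheodory_boundsD(5)[OF K]])
      have "(x t, u (t - 1)) \<in> cball 0 (2 * real j)" if t: "t \<in> {a..b}" for t
      proof -
        have "x t \<in> cball 0 (real j)" "u (t - 1) \<in> cball 0 (real j)"
          using p(2) t by (auto simp: moduli_class_def image_subset_iff)
        then show ?thesis
          using norm_Pair_le[of "x t" "u (t - 1)"] by simp
      qed
      with caratheodory_boundsD(7)[OF K]
      show "AE t in lebesgue. t \<in> {a..b} \<longrightarrow> norm (g t (x t, u (t - 1))) \<le> m t"
        by (auto elim: eventually_mono)
    qed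
    then show "?I p \<le> integral {a..b} m"
      using set_lebesgue_integral_eq_integral(2)[OF int[OF p(2)]] by (simp add: p(1))
  qed
  then have "?I (x, u) \<le> (SUP p\<in>?A. ?I p)"
    by (rule cSUP_upper[rotated]) (use x u in simp)
  then show ?thesis
    using set_lebesgue_integral_eq_integral(2)[OF int[of x u]] x u by (simp add: seminorm_Theta_def)
qed

text \<open>Increments of a solution are integrals of \<open>f\<close> along its history, hence
  bounded by the very integrals whose supremum is the modulus. The range up to
  \<open>2 * b - a\<close> arises because the modulus looks ahead by up to \<open>b - a\<close> from
  any point of \<open>{a..b}\<close>.\<close>

lemma solution_in_moduli_class:
  fixes f :: "('n::finite) rhs"
  assumes f: "f \<in> LC" "f \<in> E" and y: "solution_upto f \<phi> \<tau> y" and yJ: "\<And>r. r \<in> {- 1..\<tau>} \<Longrightarrow> norm (y r) \<le> real J"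
    and ab: "0 \<le> a" "b \<le> \<tau>" and ba: "b - a < d"
    and small: "\<And>g s t. g \<in> E \<Longrightarrow> a \<le> s \<Longrightarrow> s \<le> t \<Longrightarrow> t \<le> 2 * b - a \<Longrightarrow> t - s < d \<Longrightarrow>
      (\<integral>\<^sup>+u\<in>{s..t}. m_bound g (2 * J) u \<partial>lebesgue) \<le> ennreal 1"
  shows "y \<in> moduli_class (m_moduli E) (2 * J) a b"
proof -
  have cont: "continuous_on {- 1..\<tau>} y"
    using y by (simp add: solution_upto_def)
  have inc: "norm (y t - y s) \<le> m_moduli E (2 * J) a b (t - s)" if st: "s \<in> {a..b}" "t \<in> {a..b}" "s \<le> t" for s t
  proof -
    \<comment> \<open>Finiteness has to be shown: \<open>enn2real\<close> sends infinity to 0, and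
      the comparison would then fail.\<close>
    define X where "X = (SUP (v, g)\<in>{a..b} \<times> E. \<integral>\<^sup>+u\<in>{v..v + (t - s)}. m_bound g (2 * J) u \<partial>lebesgue)"
    have "X \<le> ennreal 1"
      unfolding X_def
    proof (rule SUP_least, clarify)
      fix v g assume "v \<in> {a..b}" "g \<in> E"
      then show "(\<integral>\<^sup>+u\<in>{v..v + (t - s)}. m_bound g (2 * J) u \<partial>lebesgue) \<le> ennreal 1"
        using st ba by (intro small) auto
    qed
    then have fin: "X < top"
      by (rule le_less_trans) simp
    have "ennreal (norm (y t - y s)) = ennreal (norm (integral {s..t} (\<lambda>u. f u (history y u))))"
      using solution_upto_increment[OF f(1) y, of s t] st ab by simp
    also have "\<dots> \<le> (\<integral>\<^sup>+u\<in>{s..t}. m_bound f (2 * J) u \<partial>lebesgue)"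
      by (rule norm_integral_history_le[OF f(1) cont yJ]) (use st ab in auto)
    also have "\<dots> \<le> X"
      unfolding X_def by (rule SUP_upper2[of "(s, f)"]) (use st f in auto)
    finally have "enn2real (ennreal (norm (y t - y s))) \<le> enn2real X"
      by (rule enn2real_mono) (use fin in simp)
    then show ?thesis
      by (simp add: m_moduli_def X_def)
  qed
  show ?thesis
    unfolding moduli_class_def admits_modulus_def
  proof (intro CollectI conjI ballI)
    show "continuous_on {a..b} y"
      using cont by (rule continuous_on_subset) (use ab in auto)
    have "norm (y r) \<le> real (2 * J)" if "r \<in> {a..b}" for r
      using yJ[of r] that ab by simp
    then show "y ` {a..b} \<subseteq> cball 0 (real (2 * J))"
      by auto
    fix t s assume ts: "t \<in> {a..b}" "s \<in> {a..b}"
    show "norm (y t - y s) \<le> m_moduli E (2 * J) a b \<bar>t - s\<bar>"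
    proof (cases "s \<le> t")
      case True
      then show ?thesis
        using inc[OF ts(2,1)] by simp
    next
      case False
      then show ?thesis
        using inc[OF ts(1,2)] by (simp add: norm_minus_commute)
    qed
  qed
qed

text \<open>A solution is itself an admissible test function on \<open>{a..b}\<close>. On the
  shifted interval it is again a solution if \<open>1 \<le> a\<close>, with the modulus of the
  m-bounds, and an initial function if \<open>b \<le> 1\<close>, with modulus
  \<open>\<theta>0\<close>; the maximum of the two moduli covers both cases.\<close>

lemma vanishing_local_error_sigma_Theta:
  fixes f :: "('n::finite) rhs"
  assumes E: "E \<subseteq> LC" "equicontinuous_m_bounds E" and fs: "\<And>n. fs n \<in> E" and f: "f \<in> LC"
    and \<theta>0: "\<And>n. admits_modulus {- 1..0} (\<phi>s n) \<theta>0"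
    and \<phi>s: "\<And>n. continuous_on {- 1..0} (\<phi>s n)"
    and lim: "limitin (sigma_Theta (m_moduli E) (max_moduli (m_moduli E) \<theta>0)) fs f sequentially"
    and T: "0 \<le> T"
  shows "vanishing_local_error fs \<phi>s f J T"
proof -
  let ?\<Theta> = "m_moduli E"
  let ?\<Theta>' = "max_moduli (m_moduli E) \<theta>0"
  \<comment> \<open>The moduli look ahead to \<open>2 * b - a\<close>, which is at most
    \<open>2 * T\<close>.\<close>
  have "0 < 2 * T + 1" "0 < (1::real)"
    using T by simp_all
  from equicontinuous_m_boundsE[OF E(2) this, where j = "2 * J"]
  obtain d where d: "0 < d" "\<And>f s t. f \<in> E \<Longrightarrow> - (2 * T + 1) \<le> s \<Longrightarrow> s \<le> t \<Longrightarrow> t \<le> 2 * T + 1 \<Longrightarrow> t - s < d \<Longrightarrow>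
      (\<integral>\<^sup>+u\<in>{s..t}. m_bound f (2 * J) u \<partial>lebesgue) \<le> ennreal 1"
    by blast
  have pos: "0 \<le> ?\<Theta> j a b s" "0 \<le> ?\<Theta>' j a b s" for j a b s
    by (simp_all add: m_moduli_def max_moduli_def le_max_iff_disj)
  show ?thesis
    unfolding vanishing_local_error_def
  proof (intro exI[of _ d] conjI allI impI d(1))
    fix a b e :: real
    assume *: "a \<in> \<rat> \<and> b \<in> \<rat> \<and> 0 \<le> a \<and> a \<le> b \<and> b \<le> T \<and> b - a < d \<and> (b \<le> 1 \<or> 1 \<le> a) \<and> 0 < e"
    then have ab: "0 \<le> a" "a \<le> b" "b \<le> T" "b - a < d" "b \<le> 1 \<or> 1 \<le> a" and "0 < e"
      by auto
    have "\<forall>\<^sub>F n in sequentially. seminorm_Theta ?\<Theta> ?\<Theta>' (2 * J) a b (\<lambda>t z. fs n t z - f t z) < e"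
    proof (rule limitin_LC_topologyD[OF lim[unfolded sigma_Theta_def] f _ _ \<open>0 < e\<close>])
      show "seminorm_Theta ?\<Theta> ?\<Theta>' (2 * J) a b \<in>
          {seminorm_Theta ?\<Theta> ?\<Theta>' j q1 q2 | j q1 q2. q1 \<in> \<rat> \<and> q2 \<in> \<rat> \<and> q1 \<le> q2}"
        using * by blast
      show "seminorm_Theta ?\<Theta> ?\<Theta>' (2 * J) a b (\<lambda>t z. 0) = 0"
        by (rule seminorm_Theta_zero) (rule pos)+
    qed
    then show "\<forall>\<^sub>F n in sequentially. \<forall>\<tau> y. b \<le> \<tau> \<and> \<tau> \<le> T \<and>
      solution_upto (fs n) (\<phi>s n) \<tau> y \<and> (\<forall>r\<in>{- 1..\<tau>}. norm (y r) \<le> real J) \<longrightarrow>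
      norm (integral {a..b} (\<lambda>s. fs n s (history y s) - f s (history y s))) \<le> e"
    proof eventually_elim
      case (elim n)
      show ?case
      proof (intro allI impI)
        fix \<tau> y
        assume "b \<le> \<tau> \<and> \<tau> \<le> T \<and> solution_upto (fs n) (\<phi>s n) \<tau> y \<and> (\<forall>r\<in>{- 1..\<tau>}. norm (y r) \<le> real J)"
        then have \<tau>: "b \<le> \<tau>" "\<tau> \<le> T" and y: "solution_upto (fs n) (\<phi>s n) \<tau> y"
          and yJ: "\<And>r. r \<in> {- 1..\<tau>} \<Longrightarrow> norm (y r) \<le> real J"
          by auto
        have fn: "fs n \<in> LC"
          using E fs by blast
        have 1: "y \<in> moduli_class ?\<Theta> (2 * J) a b"
          by (rule solution_in_moduli_class[OF fn fs y yJ ab(1) \<tau>(1) ab(4) d(2)]) (use ab in auto)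
        have 2: "y \<in> moduli_class ?\<Theta>' (2 * J) (a - 1) (b - 1)"
        proof (cases "1 \<le> a")
          case True
          have "y \<in> moduli_class ?\<Theta> (2 * J) (a - 1) (b - 1)"
            by (rule solution_in_moduli_class[OF fn fs y yJ _ _ _ d(2)]) (use True ab \<tau> in auto)
          then show ?thesis
            unfolding moduli_class_def admits_modulus_def max_moduli_def by (auto simp: le_max_iff_disj)
        next
          case False
          with ab have b1: "b \<le> 1" by simp
          have cont: "continuous_on {a - 1..b - 1} y"
            using y by (rule_tac continuous_on_subset[of "{- 1..\<tau>}"]) (use ab b1 \<tau> in \<open>auto simp: solution_upto_def\<close>)
          have yp: "y r = \<phi>s n r" if "r \<in> {a - 1..b - 1}" for r
            using y that ab b1 by (auto simp: solution_upto_def)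
          have "norm (y r) \<le> real (2 * J)" if "r \<in> {a - 1..b - 1}" for r
            using yJ[of r] that ab \<tau> by simp
          then have "y ` {a - 1..b - 1} \<subseteq> cball 0 (real (2 * J))"
            by auto
          moreover have "norm (y t - y s) \<le> ?\<Theta>' (2 * J) (a - 1) (b - 1) \<bar>t - s\<bar>"
            if "t \<in> {a - 1..b - 1}" "s \<in> {a - 1..b - 1}" for t s
          proof -
            have "norm (\<phi>s n t - \<phi>s n s) \<le> \<theta>0 \<bar>t - s\<bar>"
              using \<theta>0[of n] that ab b1 by (simp add: admits_modulus_def)
            then show ?thesis
              using yp that by (simp add: max_moduli_def)
          qed
          ultimately show ?thesis
            using cont unfolding moduli_class_def admits_modulus_def by blast
        qed
        have "norm (integral {a..b} (\<lambda>s. fs n s (y s, y (s - 1)) - f s (y s, y (s - 1)))) \<le>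
            seminorm_Theta ?\<Theta> ?\<Theta>' (2 * J) a b (\<lambda>t z. fs n t z - f t z)"
          by (rule norm_integral_le_seminorm_Theta[OF LC_diff[OF fn f] 1 2])
        then show "norm (integral {a..b} (\<lambda>s. fs n s (history y s) - f s (history y s))) \<le> e"
          using elim by (simp add: history_def)
      qed
    qed
  qed
qed

section \<open>The pointwise topology on a dense set\<close>

text \<open>Only an upper bound \<open>c\<close> for the distance is available. Dividing the
  difference by \<open>c\<close> leaves \<open>l_bound\<close> alone on the right, so its integral
  can be compared directly with the uniform bound for \<open>E\<close>.\<close>

lemma norm_diff_le_l_bound:
  assumes "z1 \<in> cball 0 (real j)" "z2 \<in> cball 0 (real j)" "norm (z1 - z2) \<le> c" "0 < c"
  shows "ennreal (norm ((f t z1 - f t z2) /\<^sub>R c)) \<le> l_bound f j t"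
proof (cases "z1 = z2")
  case False
  have "norm ((f t z1 - f t z2) /\<^sub>R c) = norm (f t z1 - f t z2) / c"
    using assms(4) by (simp add: divide_inverse)
  also have "\<dots> \<le> norm (f t z1 - f t z2) / norm (z1 - z2)"
    using False assms(3,4) by (intro divide_left_mono) auto
  finally have "ennreal (norm ((f t z1 - f t z2) /\<^sub>R c)) \<le> ennreal (norm (f t z1 - f t z2) / norm (z1 - z2))"
    by (rule ennreal_leI)
  also have "\<dots> \<le> l_bound f j t"
    unfolding l_bound_def by (rule SUP_upper2[of "(z1, z2)"]) (use assms False in auto)
  finally show ?thesis .
qed simp

lemma finite_net:
  assumes D: "closure D = (UNIV :: 'a::euclidean_space set)" and "0 < e"
  obtains Z where "finite Z" "Z \<subseteq> D" "\<And>p. p \<in> cball 0 R \<Longrightarrow> \<exists>z\<in>Z. norm (p - z) < e"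
proof -
  have cover: "cball 0 R \<subseteq> (\<Union>z\<in>D. ball z e)"
  proof
    fix p :: 'a
    have "p \<in> closure D"
      using D by simp
    then obtain z where "z \<in> D" "dist z p < e"
      using \<open>0 < e\<close> unfolding closure_approachable by blast
    then show "p \<in> (\<Union>z\<in>D. ball z e)"
      by auto
  qed
  obtain Z where Z: "Z \<subseteq> D" "finite Z" "cball 0 R \<subseteq> (\<Union>z\<in>Z. ball z e)"
    by (rule compactE_image[OF compact_cball _ cover]) auto
  have "\<exists>z\<in>Z. norm (p - z) < e" if "p \<in> cball 0 R" for p
    using Z(3) that by (force simp: dist_norm norm_minus_commute)
  with Z(1,2) that show thesis
    by blast
qed

lemma borel_measurable_step:
  fixes v :: "int \<Rightarrow> 'b::topological_space" and a d :: real
  shows "(\<lambda>t. v \<lfloor>(t - a) / d\<rfloor>) \<in> borel_measurable borel"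
proof -
  have "(\<lambda>t. \<lfloor>(t - a) / d\<rfloor>) \<in> borel \<rightarrow>\<^sub>M count_space UNIV"
    by measurable
  then show ?thesis
    by (rule measurable_compose) simp
qed

text \<open>On a short interval a solution is close to a step function with values in a finite net of points
  of \<open>D\<close>; the \<open>l\<close>-bounds control the cost of the replacement.\<close>

lemma vanishing_local_error_sigma_D:
  fixes f :: "('n::finite) rhs"
  assumes E: "E \<subseteq> LC" "equicontinuous_m_bounds E" "bounded_l_bounds E"
    and fs: "\<And>n. fs n \<in> E" and f: "f \<in> LC"
    and \<phi>: "continuous_on {- 1..0} \<phi>" and unif: "uniform_limit {- 1..0} \<phi>s \<phi> sequentially"
    and D: "closure D = UNIV" and lim: "limitin (sigma_D D) fs f sequentially"
    and T: "0 \<le> T"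
  shows "vanishing_local_error fs \<phi>s f J T"
  unfolding vanishing_local_error_def
proof (intro exI[of _ "1::real"] conjI allI impI zero_less_one)
  fix a b e :: real
  assume "a \<in> \<rat> \<and> b \<in> \<rat> \<and> 0 \<le> a \<and> a \<le> b \<and> b \<le> T \<and> b - a < 1 \<and> (b \<le> 1 \<or> 1 \<le> a) \<and> 0 < e"
  then have abQ: "a \<in> \<rat>" "b \<in> \<rat>" and ab: "0 \<le> a" "a \<le> b" "b \<le> T" "b \<le> 1 \<or> 1 \<le> a" and "0 < e"
    by auto
  \<comment> \<open>Histories have norm at most \<open>2 * J\<close>; the net points replacing them
    are at distance at most 1.\<close>
  let ?j = "2 * J + 1"
  define C where "C = (SUP g\<in>E. \<integral>\<^sup>+t\<in>{- (T + 1)..T + 1}. l_bound g ?j t \<partial>lebesgue)"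
  have "C < \<infinity>"
    unfolding C_def using E(3)[unfolded bounded_l_bounds_def, rule_format, of "T + 1"] T by simp
  then obtain Cr where Cr: "0 \<le> Cr" "C = ennreal Cr"
    by (cases C) auto
  obtain m l where K: "caratheodory_bounds f (cball 0 (real ?j)) m l"
    by (rule LC_boundsE[OF f compact_cball])
  define L where "L = integral {a..b} l"
  have "0 \<le> L"
    unfolding L_def by (rule integral_nonneg) (use caratheodory_boundsD[OF K] in auto)
  \<comment> \<open>The replacement error \<open>3 * \<eta>\<close> is multiplied by
    \<open>Cr\<close> for members of \<open>E\<close> and by \<open>L\<close> for \<open>f\<close>;
    together this must not exceed \<open>e / 2\<close>. The summand 1 keeps the denominator
    positive.\<close>
  define \<eta> where "\<eta> = min 1 (e / (6 * (Cr + L + 1)))"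
  have \<eta>: "0 < \<eta>" "\<eta> \<le> 1"
    using \<open>0 < e\<close> Cr(1) \<open>0 \<le> L\<close> by (auto simp: \<eta>_def)
  have "\<eta> \<le> e / (6 * (Cr + L + 1))"
    by (simp add: \<eta>_def)
  then have "\<eta> * (6 * (Cr + L + 1)) \<le> e"
    using Cr(1) \<open>0 \<le> L\<close> by (simp add: pos_le_divide_eq)
  then have \<eta>e: "3 * \<eta> * Cr + 3 * \<eta> * L \<le> e / 2"
    using \<eta>(1) by (simp add: algebra_simps)
  have "0 < T + 1"
    using T by simp
  from equicontinuous_m_boundsE[OF E(2) this \<eta>(1), where j = "2 * J"]
  obtain d1 where d1: "0 < d1" "\<And>f s t. f \<in> E \<Longrightarrow> - (T + 1) \<le> s \<Longrightarrow> s \<le> t \<Longrightarrow> t \<le> T + 1 \<Longrightarrow> t - s < d1 \<Longrightarrow>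
      (\<integral>\<^sup>+u\<in>{s..t}. m_bound f (2 * J) u \<partial>lebesgue) \<le> ennreal \<eta>"
    by blast
  have "uniformly_continuous_on {- 1..0} \<phi>"
    using \<phi> by (rule compact_uniformly_continuous) simp
  moreover have "0 < \<eta> / 3"
    using \<eta>(1) by simp
  ultimately obtain d2 where d2: "0 < d2" "\<And>s t. s \<in> {- 1..0} \<Longrightarrow> t \<in> {- 1..0} \<Longrightarrow> dist t s < d2 \<Longrightarrow>
      dist (\<phi> t) (\<phi> s) < \<eta> / 3"
    unfolding uniformly_continuous_on_def by blast
  obtain P :: nat where P: "(b - a) / min d1 d2 < real P"
    using reals_Archimedean2 by blast
  have dpos: "0 < min d1 d2"
    using d1(1) d2(1) by simp
  have "0 \<le> (b - a) / min d1 d2"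
    using ab dpos by simp
  with P have P0: "0 < real P"
    by linarith
  \<comment> \<open>An integer number of equal cells between rational endpoints has rational mesh
    points, as the seminorms demand, and \<open>P\<close> makes the width smaller than
    \<open>d1\<close> and \<open>d2\<close>.\<close>
  define d where "d = (b - a) / real P"
  have d: "0 \<le> d" "d < d1" "d < d2" "real P * d = b - a" "d \<in> \<rat>"
  proof -
    show "0 \<le> d" "real P * d = b - a" "d \<in> \<rat>"
      using ab P0 abQ by (auto simp: d_def)
    have "b - a < real P * min d1 d2"
      using P by (simp only: pos_divide_less_eq[OF dpos])
    then have "d < min d1 d2"
      unfolding d_def pos_divide_less_eq[OF P0] by (simp only: mult.commute)
    then show "d < d1" "d < d2"
      by auto
  qed
  obtain Z where Z: "finite Z" "Z \<subseteq> D" "\<And>p. p \<in> cball 0 (2 * real J) \<Longrightarrow> \<exists>z\<in>Z. norm (p - z) < \<eta>"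
    by (rule finite_net[OF D \<eta>(1), of "2 * real J"]) (rule that)
  \<comment> \<open>These finitely many conditions are fixed before any solution is chosen; they
    serve all solutions in the ball at once.\<close>
  have "\<forall>\<^sub>F n in sequentially. \<forall>p\<in>{..<P} \<times> Z. case p of (i, z) \<Rightarrow>
      seminorm_point z (a + real i * d) (a + real (Suc i) * d) (\<lambda>t z. fs n t z - f t z) < e / (2 * real P)"
  proof (rule eventually_ball_finite)
    show "finite ({..<P} \<times> Z)"
      using Z(1) by simp
    show "\<forall>p\<in>{..<P} \<times> Z. \<forall>\<^sub>F n in sequentially. case p of (i, z) \<Rightarrow>
      seminorm_point z (a + real i * d) (a + real (Suc i) * d) (\<lambda>t z. fs n t z - f t z) < e / (2 * real P)"
    proof (clarify)
      fix i z assume i: "i < P" and z: "z \<in> Z"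
      show "\<forall>\<^sub>F n in sequentially.
        seminorm_point z (a + real i * d) (a + real (Suc i) * d) (\<lambda>t z. fs n t z - f t z) < e / (2 * real P)"
      proof (rule limitin_LC_topologyD[OF lim[unfolded sigma_D_def] f])
        have "a + real i * d \<in> \<rat>" "a + real (Suc i) * d \<in> \<rat>" "a + real i * d \<le> a + real (Suc i) * d"
          using abQ d by (auto intro!: mult_right_mono)
        then show "seminorm_point z (a + real i * d) (a + real (Suc i) * d) \<in>
            {seminorm_point z q1 q2 | z q1 q2. z \<in> D \<and> q1 \<in> \<rat> \<and> q2 \<in> \<rat> \<and> q1 \<le> q2}"
          using z Z(2) by blast
        show "seminorm_point z (a + real i * d) (a + real (Suc i) * d) (\<lambda>t z. 0) = 0"
          by (simp add: seminorm_point_def set_lebesgue_integral_def)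
        show "0 < e / (2 * real P)"
          using \<open>0 < e\<close> P0 by simp
      qed
    qed
  qed
  moreover have "\<forall>\<^sub>F n in sequentially. \<forall>r\<in>{- 1..0}. dist (\<phi>s n r) (\<phi> r) < \<eta> / 3"
    using unif[unfolded uniform_limit_iff, rule_format, of "\<eta> / 3"] \<eta>(1) by simp
  ultimately show "\<forall>\<^sub>F n in sequentially. \<forall>\<tau> y. b \<le> \<tau> \<and> \<tau> \<le> T \<and>
      solution_upto (fs n) (\<phi>s n) \<tau> y \<and> (\<forall>r\<in>{- 1..\<tau>}. norm (y r) \<le> real J) \<longrightarrow>
      norm (integral {a..b} (\<lambda>s. fs n s (history y s) - f s (history y s))) \<le> e"
  proof eventually_elim
    case (elim n)
    show ?case
    proof (intro allI impI)
      fix \<tau> y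
      assume "b \<le> \<tau> \<and> \<tau> \<le> T \<and> solution_upto (fs n) (\<phi>s n) \<tau> y \<and> (\<forall>r\<in>{- 1..\<tau>}. norm (y r) \<le> real J)"
      then have \<tau>: "b \<le> \<tau>" "\<tau> \<le> T" and y: "solution_upto (fs n) (\<phi>s n) \<tau> y"
        and yJ: "\<And>r. r \<in> {- 1..\<tau>} \<Longrightarrow> norm (y r) \<le> real J"
        by auto
      have fn: "fs n \<in> LC"
        using E fs by blast
      have cont: "continuous_on {- 1..\<tau>} y"
        using y by (simp add: solution_upto_def)
      have osc: "norm (y t - y s) \<le> \<eta>" if "0 \<le> s" "s \<le> t" "t \<le> \<tau>" "t - s < d1" for s t
      proof -
        have "ennreal (norm (y t - y s)) = ennreal (norm (integral {s..t} (\<lambda>u. fs n u (history y u))))"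
          using solution_upto_increment[OF fn y that(1-3)] by simp
        also have "\<dots> \<le> (\<integral>\<^sup>+u\<in>{s..t}. m_bound (fs n) (2 * J) u \<partial>lebesgue)"
          by (rule norm_integral_history_le[OF fn cont yJ that(1,3)])
        also have "\<dots> \<le> ennreal \<eta>"
          by (rule d1(2)[OF fs]; use that \<tau> T in linarith)
        finally show ?thesis
          using \<eta>(1) by (simp add: ennreal_le_iff)
      qed
      \<comment> \<open>Equicontinuity of the initial functions comes from their uniform convergence
        and the uniform continuity of the limit, one third of \<open>\<eta>\<close> for each of the
        three differences.\<close>
      have osc0: "norm (y t - y s) \<le> \<eta>" if "- 1 \<le> s" "s \<le> t" "t \<le> 0" "t - s < d2" for s t
      proof -
        have "y t = \<phi>s n t" "y s = \<phi>s n s"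
          using y that by (auto simp: solution_upto_def)
        moreover have "dist (\<phi>s n t) (\<phi> t) < \<eta> / 3" "dist (\<phi>s n s) (\<phi> s) < \<eta> / 3"
          using elim(2) that by auto
        moreover have "dist (\<phi> t) (\<phi> s) < \<eta> / 3"
          using d2(2)[of s t] that by (simp add: dist_real_def)
        ultimately have "dist (y t) (y s) < \<eta>"
          using dist_triangle[of "\<phi>s n t" "\<phi>s n s" "\<phi> t"] dist_triangle[of "\<phi> t" "\<phi>s n s" "\<phi> s"]
          by (simp add: dist_commute)
        then show ?thesis
          by (simp add: dist_norm)
      qed
      have hosc: "norm (history y t - history y s) \<le> 2 * \<eta>" if "a \<le> s" "s \<le> t" "t \<le> b" "t - s \<le> d" for s t
      proof (rule norm_history_diff_le)
        show "norm (y t - y s) \<le> \<eta>"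
          by (rule osc) (use that ab \<tau> d in auto)
        show "norm (y (t - 1) - y (s - 1)) \<le> \<eta>"
        proof (cases "1 \<le> a")
          case True
          then show ?thesis
            by (intro osc) (use that ab \<tau> d in auto)
        next
          case False
          then show ?thesis
            by (intro osc0) (use that ab \<tau> d in auto)
        qed
      qed
      have hin: "norm (history y s) \<le> 2 * real J" if "s \<in> {a..b}" for s
        using norm_history_le[of y s "real J"] yJ[of s] yJ[of "s - 1"] that ab \<tau> by auto
      \<comment> \<open>Indices outside the interval get an arbitrary net point, so that the choice
        is defined on all integers and always takes values in \<open>Z\<close>.\<close>
      have "\<exists>z. z \<in> Z \<and> (a + real_of_int i * d \<in> {a..b} \<longrightarrow> norm (history y (a + real_of_int i * d) - z) < \<eta>)" for i
      proof (cases "a + real_of_int i * d \<in> {a..b}")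
        case True
        then show ?thesis
          using Z(3)[of "history y (a + real_of_int i * d)"] hin by auto
      next
        case False
        have "\<exists>z. z \<in> Z"
          using Z(3)[of 0] by auto
        with False show ?thesis
          by blast
      qed
      then obtain v where v: "\<And>i. v i \<in> Z"
        "\<And>i. a + real_of_int i * d \<in> {a..b} \<Longrightarrow> norm (history y (a + real_of_int i * d) - v i) < \<eta>"
        using choice[of "\<lambda>i z. z \<in> Z \<and> (a + real_of_int i * d \<in> {a..b} \<longrightarrow> norm (history y (a + real_of_int i * d) - z) < \<eta>)"]
        by auto
      \<comment> \<open>On each cell the value is the net point chosen at the left endpoint: an
        oscillation of at most \<open>2 * \<eta>\<close> plus the net distance gives
        \<open>3 * \<eta>\<close>.\<close>
      define w where "w t = v \<lfloor>(t - a) / d\<rfloor>" for t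
      have wmeas: "w \<in> borel_measurable borel"
        unfolding w_def by (rule borel_measurable_step)
      show "norm (integral {a..b} (\<lambda>s. fs n s (history y s) - f s (history y s))) \<le> e"
      \<comment> \<open>For \<open>a = b\<close> the width \<open>d\<close> is 0 and the floor does
        not describe cells.\<close>
      proof (cases "a = b")
        case True
        then show ?thesis
          using \<open>0 < e\<close> by simp
      next
        case False
        then have "a < b"
          using ab by simp
        then have d0: "0 < d"
          using P0 by (simp add: d_def)
        have close: "norm (history y t - w t) \<le> 3 * \<eta>" if t: "t \<in> {a..b}" for t
        proof -
          define i where "i = \<lfloor>(t - a) / d\<rfloor>"
          have "real_of_int i \<le> (t - a) / d" "(t - a) / d < real_of_int i + 1" "0 \<le> i"
            using t d0 by (auto simp: i_def)
          then have i: "a + real_of_int i * d \<le> t" "t < a + real_of_int i * d + d" "0 \<le> real_of_int i * d"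
            using d0 by (auto simp: field_simps)
          have "norm (history y t - history y (a + real_of_int i * d)) \<le> 2 * \<eta>"
            by (rule hosc) (use i t in auto)
          moreover have "norm (history y (a + real_of_int i * d) - v i) < \<eta>"
            by (rule v(2)) (use i t in auto)
          ultimately show ?thesis
            using norm_triangle_ineq[of "history y t - history y (a + real_of_int i * d)" "history y (a + real_of_int i * d) - v i"]
            by (simp add: w_def i_def)
        qed
        have vin: "norm z \<le> real ?j" if "z \<in> Z" "norm (history y s - z) < \<eta>" "s \<in> {a..b}" for z s
          using norm_triangle_sub[of z "history y s"] hin[OF that(3)] that(2) \<eta>(2)
          by (simp add: norm_minus_commute)
        have win: "w t \<in> cball 0 (real ?j)" if t: "t \<in> {a..b}" for t
        proof -
          define i where "i = \<lfloor>(t - a) / d\<rfloor>"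
          have "real_of_int i \<le> (t - a) / d" "0 \<le> i"
            using t d0 by (auto simp: i_def)
          then have "a + real_of_int i * d \<in> {a..b}"
            using d0 t by (auto simp: field_simps)
          from vin[OF v(1) v(2)[OF this] this] show ?thesis
            by (simp add: w_def i_def)
        qed
        have hin': "history y t \<in> cball 0 (real ?j)" if "t \<in> {a..b}" for t
          using hin[OF that] by simp
        have inth: "(\<lambda>t. g t (history y t)) absolutely_integrable_on {a..b}" if "g \<in> LC" for g :: "'n rhs"
          by (rule integrable_along_history(1)[OF that cont ab(1) \<tau>(1)])
        have intw: "(\<lambda>t. g t (w t)) absolutely_integrable_on {a..b}" if "g \<in> LC" for g :: "'n rhs"
          by (rule LC_integrable[OF that wmeas compact_cball win])
        have intd: "(\<lambda>t. g t (history y t) - g t (w t)) absolutely_integrable_on {a..b}" if "g \<in> LC" for g :: "'n rhs"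
          using inth[OF that] intw[OF that] by (rule set_integral_diff(1))
        have A: "norm (integral {a..b} (\<lambda>t. fs n t (history y t) - fs n t (w t))) \<le> 3 * \<eta> * Cr"
        proof -
          let ?F = "\<lambda>t. (fs n t (history y t) - fs n t (w t)) /\<^sub>R (3 * \<eta>)"
          have "ennreal (norm (integral {a..b} ?F)) \<le> (\<integral>\<^sup>+t\<in>{a..b}. l_bound (fs n) ?j t \<partial>lebesgue)"
          proof (rule norm_integral_le_nn_integral)
            show "?F absolutely_integrable_on {a..b}"
              using intd[OF fn] by simp
            show "ennreal (norm (?F t)) \<le> l_bound (fs n) ?j t" if "t \<in> {a..b}" for t
              by (rule norm_diff_le_l_bound[OF hin'[OF that] win[OF that] close[OF that]]) (use \<eta> in simp)
          qed
          also have "\<dots> \<le> (\<integral>\<^sup>+t\<in>{- (T + 1)..T + 1}. l_bound (fs n) ?j t \<partial>lebesgue)"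
            by (rule nn_integral_mono) (use ab in \<open>auto simp: indicator_def\<close>)
          also have "\<dots> \<le> C"
            unfolding C_def using fs by (rule SUP_upper)
          finally have "norm (integral {a..b} ?F) \<le> Cr"
            using Cr by (simp add: ennreal_le_iff)
          moreover have "integral {a..b} ?F = integral {a..b} (\<lambda>t. fs n t (history y t) - fs n t (w t)) /\<^sub>R (3 * \<eta>)"
            by (rule integral_cmul)
          moreover have "0 < 3 * \<eta>"
            using \<eta>(1) by simp
          ultimately have "norm (integral {a..b} (\<lambda>t. fs n t (history y t) - fs n t (w t))) / (3 * \<eta>) \<le> Cr"
            by (simp only: norm_scaleR abs_of_pos positive_imp_inverse_positive divide_inverse_commute)
          then show ?thesis
            unfolding pos_divide_le_eq[OF \<open>0 < 3 * \<eta>\<close>] by (subst mult.commute)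
        qed
        have B: "norm (integral {a..b} (\<lambda>t. f t (history y t) - f t (w t))) \<le> 3 * \<eta> * L"
        proof -
          have "norm (integral {a..b} (\<lambda>t. f t (history y t) - f t (w t))) \<le> integral {a..b} (\<lambda>t. l t * (3 * \<eta>))"
          proof (rule integral_norm_bound_AE)
            show "(\<lambda>t. f t (history y t) - f t (w t)) integrable_on {a..b}"
              using intd[OF f] by (rule set_lebesgue_integral_eq_integral(1))
            show "(\<lambda>t. l t * (3 * \<eta>)) integrable_on {a..b}"
              using caratheodory_boundsD(6)[OF K] by (rule integrable_on_mult_left)
            show "AE t in lebesgue. t \<in> {a..b} \<longrightarrow> norm (f t (history y t) - f t (w t)) \<le> l t * (3 * \<eta>)"
              using caratheodory_boundsD(8)[OF K]
            proof eventually_elim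
              case (elim t)
              show ?case
              proof
                assume t: "t \<in> {a..b}"
                then have "norm (f t (history y t) - f t (w t)) \<le> l t * norm (history y t - w t)"
                  using elim hin' win by blast
                also have "\<dots> \<le> l t * (3 * \<eta>)"
                  by (intro mult_left_mono close t caratheodory_boundsD(4)[OF K])
                finally show "norm (f t (history y t) - f t (w t)) \<le> l t * (3 * \<eta>)" .
              qed
            qed
          qed
          then show ?thesis
            by (simp add: L_def mult.commute)
        qed
        let ?g = "\<lambda>t. fs n t (w t) - f t (w t)"
        have gint: "?g integrable_on {a..b}"
          using set_integral_diff(1)[OF intw[OF fn] intw[OF f]] by (rule set_lebesgue_integral_eq_integral(1))
        have C: "norm (integral {a..b} ?g) \<le> e / 2"
        proof -
          have bP: "a + real P * d = b"
            using d(4) by simp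
          have "integral {a..b} ?g = (\<Sum>i<P. integral {a + real i * d..a + real (Suc i) * d} ?g)"
            using integral_eq_sum_mesh[OF d(1), of ?g a P] gint by (simp add: bP)
          also have "norm \<dots> \<le> (\<Sum>i<P. e / (2 * real P))"
          proof (rule sum_norm_le)
            fix i assume i: "i \<in> {..<P}"
            let ?I = "{a + real i * d..a + real (Suc i) * d}"
            define z where "z = v (int i)"
            have "integral ?I ?g = integral ?I (\<lambda>t. fs n t z - f t z)"
            \<comment> \<open>At the right endpoint the floor already jumps to the next
              cell.\<close>
            proof (rule integral_spike[of "{a + real (Suc i) * d}"])
              fix t assume t: "t \<in> ?I - {a + real (Suc i) * d}"
              then have "real i \<le> (t - a) / d" "(t - a) / d < real i + 1"
                using d0 by (auto simp: field_simps)
              then have "\<lfloor>(t - a) / d\<rfloor> = int i"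
                by (simp add: floor_eq_iff)
              then show "fs n t z - f t z = ?g t"
                by (simp add: w_def z_def)
            qed simp
            also have "\<dots> = (LINT t:?I|lebesgue. fs n t z - f t z)"
              by (rule set_lebesgue_integral_eq_integral(2)[symmetric])
                (intro LC_integrable_continuous[OF LC_diff[OF fn f]] continuous_on_const)
            finally have "norm (integral ?I ?g) = seminorm_point z (a + real i * d) (a + real (Suc i) * d) (\<lambda>t z. fs n t z - f t z)"
              by (simp add: seminorm_point_def)
            also have "\<dots> < e / (2 * real P)"
              using elim(1) i v(1)[of "int i"] by (auto simp: z_def)
            finally show "norm (integral ?I ?g) \<le> e / (2 * real P)"
              by simp
          qed
          also have "\<dots> = e / 2"
            using P0 by simp
          finally show ?thesis .
        qed
        note i1 = set_lebesgue_integral_eq_integral(1)[OF intd[OF fn]]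
        note i2 = set_lebesgue_integral_eq_integral(1)[OF intd[OF f]]
        have "integral {a..b} (\<lambda>s. fs n s (history y s) - f s (history y s)) =
            integral {a..b} (\<lambda>s. ((fs n s (history y s) - fs n s (w s)) - (f s (history y s) - f s (w s))) + ?g s)"
          by (rule integral_cong) simp
        also have "\<dots> = integral {a..b} (\<lambda>s. fs n s (history y s) - fs n s (w s)) -
            integral {a..b} (\<lambda>s. f s (history y s) - f s (w s)) + integral {a..b} ?g"
          using integrable_diff[OF i1 i2] gint i1 i2 by (simp only: integral_add integral_diff)
        also have "norm \<dots> \<le> (3 * \<eta> * Cr + 3 * \<eta> * L) + e / 2"
          using A B C by (intro norm_triangle_mono order_trans[OF norm_triangle_ineq4] add_mono)
        also have "\<dots> \<le> e"
          using \<eta>e by simp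
        finally show ?thesis .
      qed
    qed
  qed
qed

theorem theorem3p6:
  fixes E :: "('n::finite) rhs set"
    and fs :: "nat \<Rightarrow> 'n rhs" and f :: "'n rhs"
    and \<phi>s :: "nat \<Rightarrow> real \<Rightarrow> real^'n" and \<phi> :: "real \<Rightarrow> real^'n"
  assumes "E \<subseteq> LC" and "equicontinuous_m_bounds E"
    and "\<And>n. continuous_on {- 1..0} (\<phi>s n)" and "continuous_on {- 1..0} \<phi>"
    and "uniform_limit {- 1..0} \<phi>s \<phi> sequentially"
    and "\<And>n. fs n \<in> E" and "f \<in> LC"
  shows "(\<forall>\<theta>0. is_modulus \<theta>0 \<and>
              (\<forall>n. admits_modulus {- 1..0} (\<phi>s n) \<theta>0) \<and> admits_modulus {- 1..0} \<phi> \<theta>0 \<and>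
              limitin (sigma_Theta (m_moduli E) (max_moduli (m_moduli E) \<theta>0)) fs f sequentially
            \<longrightarrow> solutions_converge fs \<phi>s f \<phi>) \<and>
         (\<forall>D. bounded_l_bounds E \<and> countable D \<and> closure D = UNIV \<and>
              limitin (sigma_D D) fs f sequentially
            \<longrightarrow> solutions_converge fs \<phi>s f \<phi>)"
proof -
  have fsLC: "fs n \<in> LC" for n
    using assms(1,6) by blast
  \<comment> \<open>Both parts share everything except the proof that the local error
    vanishes.\<close>
  have conv: "solutions_converge fs \<phi>s f \<phi>" if "\<And>J T. 0 \<le> T \<Longrightarrow> vanishing_local_error fs \<phi>s f J T"
    using vanishing_error_if_local[OF assms(1,2,6,7) that]
    by (intro solutions_converge_if_vanishing_error[OF assms(7) fsLC assms(4,3,5)])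
  show ?thesis
  proof (intro conjI allI impI conv; elim conjE)
    fix \<theta>0 J T
    assume "\<forall>n. admits_modulus {- 1..0} (\<phi>s n) \<theta>0"
      "limitin (sigma_Theta (m_moduli E) (max_moduli (m_moduli E) \<theta>0)) fs f sequentially" "0 \<le> (T::real)"
    then show "vanishing_local_error fs \<phi>s f J T"
      by (intro vanishing_local_error_sigma_Theta[OF assms(1,2,6,7) _ assms(3)]) auto
  next
    fix D J T
    assume "bounded_l_bounds E" "closure D = UNIV" "limitin (sigma_D D) fs f sequentially" "0 \<le> (T::real)"
    then show "vanishing_local_error fs \<phi>s f J T"
      by (intro vanishing_local_error_sigma_D[OF assms(1,2) _ assms(6,7,4,5)])
  qed
qed

end
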